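(* Let $\mathcal{T}=\mathcal{T}_3(\mathcal{R}_i;\mathcal{M}_{ij})$ be a triangular 3-matrix ring and let $k\in\{1,3\}$. Assume that $Q_{k}\mathcal{Z}(\mathcal{T})Q_{k}=\mathcal{Z}(\mathcal{T}_{k})$ and $Q'_{k}\mathcal{Z}(\mathcal{T})Q'_{k}=\mathcal{Z}(\mathcal{T}'_{k})$. If every multiplicative Lie derivation from $\mathcal{T}'_k$ into itself has the standard form, then each multiplicative Lie derivation $\varphi:\mathcal{T}\to\mathcal{T}$ has the form $$\varphi=\delta+\gamma+\xi,$$ where $\delta:\mathcal{T}\to\mathcal{T}$ is a derivation, $\gamma:\mathcal{T}\to\mathcal{Z}(\mathcal{T})$ is a center valued map such that $\gamma([x,y])=0$ for all $x,y\in\mathcal{T}$, and $\xi:\mathcal{T}\to\mathcal{S}_{k}$ is a multiplicative Lie derivation (that is, $\xi$ is a multiplicative Lie derivation of $\mathcal{T}$ whose range is contained in $\mathcal{S}_k$).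
   Context: All rings are associative. For a ring $R$, $[x,y]=xy-yx$, and $\mathcal{Z}(R)=\{z\in R: [z,x]=0\ \forall x\in R\}$ is its center. A map $\varphi:R\to R$ (no additivity assumed) is a multiplicative Lie derivation if $\varphi([x,y])=[\varphi(x),y]+[x,\varphi(y)]$ for all $x,y\in R$. A derivation of $R$ is an additive map $\delta:R\to R$ with $\delta(xy)=\delta(x)y+x\delta(y)$ for all $x,y\in R$. A multiplicative Lie derivation $\varphi:R\to R$ has the standard form if $\varphi=\delta+\gamma$ with $\delta$ a derivation of $R$ and $\gamma:R\to\mathcal{Z}(R)$ a map (not assumed additive) with $\gamma([x,y])=0$ for all $x,y\in R$. Triangular 3-matrix ring: let $\mathcal{R}_1,\mathcal{R}_2,\mathcal{R}_3$ be unital rings and, for $1\le i\le j\le 3$, let $\mathcal{M}_{ij}$ be a (unital) $(\mathcal{R}_i,\mathcal{R}_j)$-bimodule with $\mathcal{M}_{ii}=\mathcal{R}_i$. For $1\le i\le j\le k\le 3$ let $\varphi_{ijk}:\mathcal{M}_{ij}\otimes_{\mathcal{R}_j}\mathcal{M}_{jk}\to\mathcal{M}_{ik}$ be $(\mathcal{R}_i,\mathcal{R}_k)$-bimodule homomorphisms, where $\varphi_{iij}$ and $\varphi_{ijj}$ are the canonical multiplication maps; write $ab=\varphi_{ijk}(a\otimes b)$. Assume that for all $1\le i<j\le 3$, $\mathcal{M}_{ij}$ is faithful as a left $\mathcal{R}_i$-module ($a\mathcal{M}_{ij}=0$ implies $a=0$ for $a\in\mathcal{R}_i$) and faithful as a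 right $\mathcal{R}_j$-module ($\mathcal{M}_{ij}b=0$ implies $b=0$ for $b\in\mathcal{R}_j$). Then $\mathcal{T}=\mathcal{T}_3(\mathcal{R}_i;\mathcal{M}_{ij})$ is the ring, under the usual matrix operations, of all upper triangular matrices $$\begin{pmatrix} r_{11}&m_{12}&m_{13}\\ 0&r_{22}&m_{23}\\ 0&0&r_{33}\end{pmatrix},\qquad r_{ii}\in\mathcal{R}_i,\ m_{ij}\in\mathcal{M}_{ij}.$$ $Q_i\in\mathcal{T}$ is the idempotent matrix with $1\in\mathcal{R}_i$ in position $(i,i)$ and $0$ elsewhere; $I=Q_1+Q_2+Q_3$ is the unit; $Q_i'=I-Q_i$; $\mathcal{T}_i=Q_i\mathcal{T}Q_i$ and $\mathcal{T}'_i=Q'_i\mathcal{T}Q'_i$ (rings with units $Q_i$ and $Q_i'$). Let $\mathcal{V}_{23}=\{w_{23}\in\mathcal{M}_{23}: m_{12}w_{23}=0\ \forall m_{12}\in\mathcal{M}_{12}\}$ and $\mathcal{V}_{12}=\{w_{12}\in\mathcal{M}_{12}: w_{12}m_{23}=0\ \forall m_{23}\in\mathcal{M}_{23}\}$. $\mathcal{S}_1$ is the set of matrices in $\mathcal{T}$ whose $(2,3)$ entry lies in $\mathcal{V}_{23}$ and all of whose other entries are $0$; $\mathcal{S}_3$ is the set of matrices in $\mathcal{T}$ whose $(1,2)$ entry lies in $\mathcal{V}_{12}$ and all of whose other entries are $0$. *)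

theory Defs
  imports "HOL-Algebra.Ring"
begin

section \<open>Multiplicative Lie derivations\<close>

text \<open>Maps between carriers are total HOL functions of which only the values on the carrier
  matter.\<close>

definition lie_bracket :: "('a, 'b) ring_scheme \<Rightarrow> 'a \<Rightarrow> 'a \<Rightarrow> 'a" where
  "lie_bracket A x y = (x \<otimes>\<^bsub>A\<^esub> y) \<ominus>\<^bsub>A\<^esub> (y \<otimes>\<^bsub>A\<^esub> x)"

definition ring_center :: "('a, 'b) ring_scheme \<Rightarrow> 'a set" where
  "ring_center A = {z \<in> carrier A. \<forall>x \<in> carrier A. lie_bracket A z x = \<zero>\<^bsub>A\<^esub>}"

definition mult_lie_derivation :: "('a, 'b) ring_scheme \<Rightarrow> ('a \<Rightarrow> 'a) \<Rightarrow> bool" where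
  "mult_lie_derivation A f \<longleftrightarrow>
     f \<in> carrier A \<rightarrow> carrier A \<and>
     (\<forall>x \<in> carrier A. \<forall>y \<in> carrier A.
        f (lie_bracket A x y) = lie_bracket A (f x) y \<oplus>\<^bsub>A\<^esub> lie_bracket A x (f y))"

definition ring_derivation :: "('a, 'b) ring_scheme \<Rightarrow> ('a \<Rightarrow> 'a) \<Rightarrow> bool" where
  "ring_derivation A d \<longleftrightarrow>
     d \<in> carrier A \<rightarrow> carrier A \<and>
     (\<forall>x \<in> carrier A. \<forall>y \<in> carrier A. d (x \<oplus>\<^bsub>A\<^esub> y) = d x \<oplus>\<^bsub>A\<^esub> d y) \<and>
     (\<forall>x \<in> carrier A. \<forall>y \<in> carrier A.
        d (x \<otimes>\<^bsub>A\<^esub> y) = (d x \<otimes>\<^bsub>A\<^esub> y) \<oplus>\<^bsub>A\<^esub> (x \<otimes>\<^bsub>A\<^esub> d y))"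

definition central_vanishing_on_brackets :: "('a, 'b) ring_scheme \<Rightarrow> ('a \<Rightarrow> 'a) \<Rightarrow> bool" where
  "central_vanishing_on_brackets A g \<longleftrightarrow>
     g \<in> carrier A \<rightarrow> ring_center A \<and>
     (\<forall>x \<in> carrier A. \<forall>y \<in> carrier A. g (lie_bracket A x y) = \<zero>\<^bsub>A\<^esub>)"

definition has_standard_form :: "('a, 'b) ring_scheme \<Rightarrow> ('a \<Rightarrow> 'a) \<Rightarrow> bool" where
  "has_standard_form A f \<longleftrightarrow>
     (\<exists>d g. ring_derivation A d \<and> central_vanishing_on_brackets A g \<and>
            (\<forall>x \<in> carrier A. f x = d x \<oplus>\<^bsub>A\<^esub> g x))"

definition corner :: "('a, 'b) ring_scheme \<Rightarrow> 'a \<Rightarrow> 'a set \<Rightarrow> 'a set" where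
  "corner A q X = (\<lambda>x. q \<otimes>\<^bsub>A\<^esub> x \<otimes>\<^bsub>A\<^esub> q) ` X"

definition corner_ring :: "('a, 'b) ring_scheme \<Rightarrow> 'a \<Rightarrow> ('a, 'b) ring_scheme" where
  "corner_ring A q = A\<lparr>carrier := corner A q (carrier A), one := q\<rparr>"


section \<open>Triangular 3-matrix rings\<close>

text \<open>An abelian group is a ring record satisfying \<^const>\<open>abelian_group\<close>; its multiplicative
  fields are ignored.\<close>

locale bimodule = R: ring R + S: ring S + M: abelian_group M
  for R :: "('r, 'x) ring_scheme" and S :: "('s, 'y) ring_scheme"
    and M :: "('m, 'z) ring_scheme" +
  fixes lact :: "'r \<Rightarrow> 'm \<Rightarrow> 'm" and ract :: "'m \<Rightarrow> 's \<Rightarrow> 'm"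
  assumes lact_closed:
      "\<lbrakk>a \<in> carrier R; m \<in> carrier M\<rbrakk> \<Longrightarrow> lact a m \<in> carrier M"
    and lact_add_left:
      "\<lbrakk>a \<in> carrier R; a' \<in> carrier R; m \<in> carrier M\<rbrakk>
        \<Longrightarrow> lact (a \<oplus>\<^bsub>R\<^esub> a') m = lact a m \<oplus>\<^bsub>M\<^esub> lact a' m"
    and lact_add_right:
      "\<lbrakk>a \<in> carrier R; m \<in> carrier M; m' \<in> carrier M\<rbrakk>
        \<Longrightarrow> lact a (m \<oplus>\<^bsub>M\<^esub> m') = lact a m \<oplus>\<^bsub>M\<^esub> lact a m'"
    and lact_assoc:
      "\<lbrakk>a \<in> carrier R; a' \<in> carrier R; m \<in> carrier M\<rbrakk>
        \<Longrightarrow> lact (a \<otimes>\<^bsub>R\<^esub> a') m = lact a (lact a' m)"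
    and lact_one: "m \<in> carrier M \<Longrightarrow> lact \<one>\<^bsub>R\<^esub> m = m"
    and ract_closed:
      "\<lbrakk>m \<in> carrier M; b \<in> carrier S\<rbrakk> \<Longrightarrow> ract m b \<in> carrier M"
    and ract_add_left:
      "\<lbrakk>m \<in> carrier M; m' \<in> carrier M; b \<in> carrier S\<rbrakk>
        \<Longrightarrow> ract (m \<oplus>\<^bsub>M\<^esub> m') b = ract m b \<oplus>\<^bsub>M\<^esub> ract m' b"
    and ract_add_right:
      "\<lbrakk>m \<in> carrier M; b \<in> carrier S; b' \<in> carrier S\<rbrakk>
        \<Longrightarrow> ract m (b \<oplus>\<^bsub>S\<^esub> b') = ract m b \<oplus>\<^bsub>M\<^esub> ract m b'"
    and ract_assoc:
      "\<lbrakk>m \<in> carrier M; b \<in> carrier S; b' \<in> carrier S\<rbrakk>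
        \<Longrightarrow> ract m (b \<otimes>\<^bsub>S\<^esub> b') = ract (ract m b) b'"
    and ract_one: "m \<in> carrier M \<Longrightarrow> ract m \<one>\<^bsub>S\<^esub> = m"
    and lact_ract:
      "\<lbrakk>a \<in> carrier R; m \<in> carrier M; b \<in> carrier S\<rbrakk>
        \<Longrightarrow> ract (lact a m) b = lact a (ract m b)"

definition upper3 :: "(nat \<times> nat) set" where
  "upper3 = {(i, j). 1 \<le> i \<and> i \<le> j \<and> j \<le> 3}"

text \<open>The entry sets are carriers inside one type, which loses no generality (use a disjoint sum).
  \<open>\<mu> i j k a b\<close> is the product of \<open>a \<in> M i j\<close> and \<open>b \<in> M j k\<close>. In particular \<open>\<mu> i i j\<close> and
  \<open>\<mu> i j j\<close> are the left and right actions on \<open>M i j\<close>, so the structure maps with a repeated index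
  are the canonical ones by construction. A bimodule homomorphism out of the tensor product
  \<open>M i j \<otimes> M j k\<close> over \<open>R j\<close> is given as the corresponding biadditive, \<open>R j\<close>-balanced map that is
  left \<open>R i\<close>-linear and right \<open>R k\<close>-linear. Associativity of all products follows, because among
  four indices \<open>i \<le> j \<le> k \<le> l\<close> in \<open>{1..3}\<close> two neighbours coincide.\<close>

locale triangular3 =
  fixes R :: "nat \<Rightarrow> 'a ring"
    and M :: "nat \<Rightarrow> nat \<Rightarrow> 'a ring"
    and \<mu> :: "nat \<Rightarrow> nat \<Rightarrow> nat \<Rightarrow> 'a \<Rightarrow> 'a \<Rightarrow> 'a"
  assumes ring_R: "i \<in> {1..3} \<Longrightarrow> ring (R i)"
    and diag: "i \<in> {1..3} \<Longrightarrow> M i i = R i"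
    and diag_mult:
      "\<lbrakk>i \<in> {1..3}; a \<in> carrier (R i); b \<in> carrier (R i)\<rbrakk>
        \<Longrightarrow> \<mu> i i i a b = a \<otimes>\<^bsub>R i\<^esub> b"
    and bimod:
      "\<lbrakk>1 \<le> i; i \<le> j; j \<le> 3\<rbrakk> \<Longrightarrow> bimodule (R i) (R j) (M i j) (\<mu> i i j) (\<mu> i j j)"
    and mu_closed:
      "\<lbrakk>1 \<le> i; i \<le> j; j \<le> k; k \<le> 3; a \<in> carrier (M i j); b \<in> carrier (M j k)\<rbrakk>
        \<Longrightarrow> \<mu> i j k a b \<in> carrier (M i k)"
    and mu_add_left:
      "\<lbrakk>1 \<le> i; i \<le> j; j \<le> k; k \<le> 3;
        a \<in> carrier (M i j); a' \<in> carrier (M i j); b \<in> carrier (M j k)\<rbrakk>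
        \<Longrightarrow> \<mu> i j k (a \<oplus>\<^bsub>M i j\<^esub> a') b = \<mu> i j k a b \<oplus>\<^bsub>M i k\<^esub> \<mu> i j k a' b"
    and mu_add_right:
      "\<lbrakk>1 \<le> i; i \<le> j; j \<le> k; k \<le> 3;
        a \<in> carrier (M i j); b \<in> carrier (M j k); b' \<in> carrier (M j k)\<rbrakk>
        \<Longrightarrow> \<mu> i j k a (b \<oplus>\<^bsub>M j k\<^esub> b') = \<mu> i j k a b \<oplus>\<^bsub>M i k\<^esub> \<mu> i j k a b'"
    and mu_balanced:
      "\<lbrakk>1 \<le> i; i \<le> j; j \<le> k; k \<le> 3;
        a \<in> carrier (M i j); r \<in> carrier (R j); b \<in> carrier (M j k)\<rbrakk>
        \<Longrightarrow> \<mu> i j k (\<mu> i j j a r) b = \<mu> i j k a (\<mu> j j k r b)"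
    and mu_linear_left:
      "\<lbrakk>1 \<le> i; i \<le> j; j \<le> k; k \<le> 3;
        r \<in> carrier (R i); a \<in> carrier (M i j); b \<in> carrier (M j k)\<rbrakk>
        \<Longrightarrow> \<mu> i j k (\<mu> i i j r a) b = \<mu> i i k r (\<mu> i j k a b)"
    and mu_linear_right:
      "\<lbrakk>1 \<le> i; i \<le> j; j \<le> k; k \<le> 3;
        a \<in> carrier (M i j); b \<in> carrier (M j k); r \<in> carrier (R k)\<rbrakk>
        \<Longrightarrow> \<mu> i j k a (\<mu> j k k b r) = \<mu> i k k (\<mu> i j k a b) r"
    and faithful_left:
      "\<lbrakk>1 \<le> i; i < j; j \<le> 3; a \<in> carrier (R i);
        \<forall>m \<in> carrier (M i j). \<mu> i i j a m = \<zero>\<^bsub>M i j\<^esub>\<rbrakk> \<Longrightarrow> a = \<zero>\<^bsub>R i\<^esub>"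
    and faithful_right:
      "\<lbrakk>1 \<le> i; i < j; j \<le> 3; b \<in> carrier (R j);
        \<forall>m \<in> carrier (M i j). \<mu> i j j m b = \<zero>\<^bsub>M i j\<^esub>\<rbrakk> \<Longrightarrow> b = \<zero>\<^bsub>R j\<^esub>"

text \<open>A matrix is the extensional family of its entries on and above the diagonal; the zero entries
  below the diagonal are not stored.\<close>

definition tri_ring ::
  "(nat \<Rightarrow> nat \<Rightarrow> 'a ring) \<Rightarrow> (nat \<Rightarrow> nat \<Rightarrow> nat \<Rightarrow> 'a \<Rightarrow> 'a \<Rightarrow> 'a) \<Rightarrow> (nat \<times> nat \<Rightarrow> 'a) ring" where
  "tri_ring M \<mu> =
    \<lparr>carrier = (\<Pi>\<^sub>E (i, j) \<in> upper3. carrier (M i j)),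
     mult = (\<lambda>x y. \<lambda>(i, k) \<in> upper3.
               finsum (M i k) (\<lambda>j. \<mu> i j k (x (i, j)) (y (j, k))) {i..k}),
     one = (\<lambda>(i, j) \<in> upper3. if i = j then \<one>\<^bsub>M i i\<^esub> else \<zero>\<^bsub>M i j\<^esub>),
     zero = (\<lambda>(i, j) \<in> upper3. \<zero>\<^bsub>M i j\<^esub>),
     add = (\<lambda>x y. \<lambda>(i, j) \<in> upper3. x (i, j) \<oplus>\<^bsub>M i j\<^esub> y (i, j))\<rparr>"

definition tri_Q :: "(nat \<Rightarrow> nat \<Rightarrow> 'a ring) \<Rightarrow> nat \<Rightarrow> nat \<times> nat \<Rightarrow> 'a" where
  "tri_Q M l = (\<lambda>(i, j) \<in> upper3. if i = l \<and> j = l then \<one>\<^bsub>M l l\<^esub> else \<zero>\<^bsub>M i j\<^esub>)"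

definition tri_Q' ::
  "(nat \<Rightarrow> nat \<Rightarrow> 'a ring) \<Rightarrow> (nat \<Rightarrow> nat \<Rightarrow> nat \<Rightarrow> 'a \<Rightarrow> 'a \<Rightarrow> 'a) \<Rightarrow> nat \<Rightarrow> nat \<times> nat \<Rightarrow> 'a" where
  "tri_Q' M \<mu> l = \<one>\<^bsub>tri_ring M \<mu>\<^esub> \<ominus>\<^bsub>tri_ring M \<mu>\<^esub> tri_Q M l"

definition tri_V23 ::
  "(nat \<Rightarrow> nat \<Rightarrow> 'a ring) \<Rightarrow> (nat \<Rightarrow> nat \<Rightarrow> nat \<Rightarrow> 'a \<Rightarrow> 'a \<Rightarrow> 'a) \<Rightarrow> 'a set" where
  "tri_V23 M \<mu> =
    {w \<in> carrier (M 2 3). \<forall>m \<in> carrier (M 1 2). \<mu> 1 2 3 m w = \<zero>\<^bsub>M 1 3\<^esub>}"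

definition tri_V12 ::
  "(nat \<Rightarrow> nat \<Rightarrow> 'a ring) \<Rightarrow> (nat \<Rightarrow> nat \<Rightarrow> nat \<Rightarrow> 'a \<Rightarrow> 'a \<Rightarrow> 'a) \<Rightarrow> 'a set" where
  "tri_V12 M \<mu> =
    {w \<in> carrier (M 1 2). \<forall>m \<in> carrier (M 2 3). \<mu> 1 2 3 w m = \<zero>\<^bsub>M 1 3\<^esub>}"

definition tri_S1 ::
  "(nat \<Rightarrow> nat \<Rightarrow> 'a ring) \<Rightarrow> (nat \<Rightarrow> nat \<Rightarrow> nat \<Rightarrow> 'a \<Rightarrow> 'a \<Rightarrow> 'a) \<Rightarrow> (nat \<times> nat \<Rightarrow> 'a) set" where
  "tri_S1 M \<mu> =
    {x \<in> carrier (tri_ring M \<mu>). x (2, 3) \<in> tri_V23 M \<mu> \<and>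
       (\<forall>(i, j) \<in> upper3 - {(2, 3)}. x (i, j) = \<zero>\<^bsub>M i j\<^esub>)}"

definition tri_S3 ::
  "(nat \<Rightarrow> nat \<Rightarrow> 'a ring) \<Rightarrow> (nat \<Rightarrow> nat \<Rightarrow> nat \<Rightarrow> 'a \<Rightarrow> 'a \<Rightarrow> 'a) \<Rightarrow> (nat \<times> nat \<Rightarrow> 'a) set" where
  "tri_S3 M \<mu> =
    {x \<in> carrier (tri_ring M \<mu>). x (1, 2) \<in> tri_V12 M \<mu> \<and>
       (\<forall>(i, j) \<in> upper3 - {(1, 2)}. x (i, j) = \<zero>\<^bsub>M i j\<^esub>)}"

end

theory Submission
  imports Defs
begin

text \<open>Put \<open>e = Q\<^sub>1\<close> and \<open>f = I - Q\<^sub>1\<close>. Since \<open>f T e = 0\<close>, the ring splits as \<open>T = A + N + B\<close> with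
  corners \<open>A = e T e\<close>, \<open>B = f T f\<close> and the square-zero \<open>(A, B)\<close>-bimodule \<open>N = e T f\<close>. The left
  action of \<open>A\<close> on \<open>N\<close> is faithful, the right action of \<open>B\<close> need not be: its annihilator is the ideal
  \<open>S\<^sub>1\<close>, which is why the extra summand \<open>\<xi>\<close> appears. The case \<open>k = 3\<close> is the same statement for the
  opposite ring with \<open>e = Q\<^sub>3\<close>, because brackets change sign but multiplicative Lie derivations,
  derivations and centres stay the same.

  Subtracting an inner derivation makes \<open>e \<phi>(e) f = 0\<close>, and \<open>[e, x] = e x f\<close> then forces \<open>\<phi>\<close> to
  commute with the projection to \<open>N\<close> and \<open>\<phi>(e)\<close> to be central. On \<open>N\<close> the map is additive, because
  \<open>n + m = [e + n, f + m]\<close>.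

  For \<open>a \<in> A\<close> the \<open>B\<close>-component of \<open>\<phi>(a)\<close> is central in \<open>B\<close>, so it lifts to a central \<open>z\<close> of \<open>T\<close>;
  subtracting \<open>z\<close> leaves \<open>d a \<in> A\<close> with \<open>\<phi>(a n) = d a n + a \<phi>(n)\<close>, and faithfulness makes \<open>d\<close> a
  derivation (lemma \<open>upper_derivation\<close>). On \<open>B\<close> the hypothesis provides a derivation \<open>d\<close> and central
  values; lifting these to the centre of \<open>T\<close> gives \<open>\<phi>(n b) = \<phi>(n) b + n d b + h b n\<close> with \<open>h b \<in> A\<close>. That
  \<open>h = 0\<close> (lemma \<open>lower_derivation\<close>) is where the third diagonal block enters: \<open>f = Q\<^sub>2 + Q\<^sub>3\<close>
  and \<open>A\<close> acts faithfully on both \<open>M\<^sub>1\<^sub>2\<close> and \<open>M\<^sub>1\<^sub>3\<close>.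

  The three pieces form a derivation \<open>\<delta>\<close> of \<open>T\<close>, and \<open>\<tau> = \<phi> - \<delta>\<close> vanishes on \<open>N\<close>, hence takes values
  in the centralizer of \<open>N\<close> in \<open>A + B\<close>, which is \<open>Z(T) + S\<^sub>1\<close> (lemma \<open>centralizer_NN\<close>). Since \<open>S\<^sub>1\<close> is an ideal,
  \<open>\<tau>\<close> maps brackets into \<open>S\<^sub>1\<close>. So \<open>\<tau>(x)\<close> can be written as \<open>\<gamma>(x) + \<xi>(x)\<close> with \<open>\<gamma>(x)\<close> central and \<open>\<xi>(x)\<close> in
  \<open>S\<^sub>1\<close> in such a way that \<open>\<gamma>(x) = 0\<close> whenever \<open>\<tau>(x) \<in> S\<^sub>1\<close>, and this choice has the required
  properties.\<close>

section \<open>Lie brackets and derivations in a ring\<close>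

context ring
begin

lemma lie_bracket_closed [simp, intro]:
  "\<lbrakk>x \<in> carrier R; y \<in> carrier R\<rbrakk> \<Longrightarrow> lie_bracket R x y \<in> carrier R"
  by (simp add: lie_bracket_def)

lemma minus_cancel_right:
  "\<lbrakk>x \<in> carrier R; y \<in> carrier R\<rbrakk> \<Longrightarrow> (x \<oplus> y) \<ominus> y = x"
  by (simp add: minus_eq a_assoc r_neg)

lemma minus_eq_zero_iff:
  "\<lbrakk>x \<in> carrier R; y \<in> carrier R\<rbrakk> \<Longrightarrow> x \<ominus> y = \<zero> \<longleftrightarrow> x = y"
  by (metis minus_eq minus_equality minus_minus a_inv_closed r_neg)

lemma ring_center_iff:
  "z \<in> ring_center R \<longleftrightarrow> z \<in> carrier R \<and> (\<forall>x \<in> carrier R. z \<otimes> x = x \<otimes> z)"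
  unfolding ring_center_def lie_bracket_def
  by (auto simp: minus_eq_zero_iff)

lemma inner_derivation:
  assumes c: "c \<in> carrier R"
  shows "ring_derivation R (\<lambda>x. lie_bracket R x c)"
  unfolding ring_derivation_def
proof (intro conjI ballI)
  fix x y assume x: "x \<in> carrier R" and y: "y \<in> carrier R"
  show "lie_bracket R (x \<oplus> y) c = lie_bracket R x c \<oplus> lie_bracket R y c"
    using x y c by (simp add: lie_bracket_def) algebra
  show "lie_bracket R (x \<otimes> y) c = lie_bracket R x c \<otimes> y \<oplus> x \<otimes> lie_bracket R y c"
    using x y c by (simp add: lie_bracket_def) algebra
qed (use c in simp)

lemma ring_derivation_add:
  assumes "ring_derivation R d" "ring_derivation R d'"
  shows "ring_derivation R (\<lambda>x. d x \<oplus> d' x)"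
proof -
  have d: "d x \<in> carrier R" "d' x \<in> carrier R" if "x \<in> carrier R" for x
    using assms that by (auto simp: ring_derivation_def)
  show ?thesis
    using assms d unfolding ring_derivation_def
    by (simp add: l_distr r_distr a_ac)
qed

lemma ring_derivation_bracket:
  assumes "ring_derivation R d" and x: "x \<in> carrier R" and y: "y \<in> carrier R"
  shows "d (lie_bracket R x y) = lie_bracket R (d x) y \<oplus> lie_bracket R x (d y)"
proof -
  have cl: "d x \<in> carrier R" if "x \<in> carrier R" for x
    using assms that by (auto simp: ring_derivation_def)
  have add: "d (x \<oplus> y) = d x \<oplus> d y" if "x \<in> carrier R" "y \<in> carrier R" for x y
    using assms that by (auto simp: ring_derivation_def)
  have "d \<zero> = \<zero>" using add[of \<zero> \<zero>] cl[of \<zero>] by simp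
  then have neg: "d (\<ominus> x) = \<ominus> d x" if "x \<in> carrier R" for x
    using add[of "\<ominus> x" x] that cl by (metis a_inv_closed l_neg minus_equality)
  have "d x \<in> carrier R" "d y \<in> carrier R" using x y by (auto intro: cl)
  then show "d (lie_bracket R x y) = lie_bracket R (d x) y \<oplus> lie_bracket R x (d y)"
    using x y assms
    by (simp add: lie_bracket_def minus_eq add neg ring_derivation_def minus_add a_ac)
qed

lemma mult_lie_derivation_diff:
  assumes f: "mult_lie_derivation R f" and d: "ring_derivation R d"
  shows "mult_lie_derivation R (\<lambda>x. f x \<ominus> d x)"
  unfolding mult_lie_derivation_def
proof (intro conjI ballI)
  have cl: "f x \<in> carrier R" "d x \<in> carrier R" if "x \<in> carrier R" for x
    using assms that by (auto simp: ring_derivation_def mult_lie_derivation_def)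
  then show "(\<lambda>x. f x \<ominus> d x) \<in> carrier R \<rightarrow> carrier R" by auto
  fix x y assume x: "x \<in> carrier R" and y: "y \<in> carrier R"
  have "f (lie_bracket R x y) = lie_bracket R (f x) y \<oplus> lie_bracket R x (f y)"
    using f x y by (simp add: mult_lie_derivation_def)
  moreover note ring_derivation_bracket[OF d x y]
  ultimately show "f (lie_bracket R x y) \<ominus> d (lie_bracket R x y) =
      lie_bracket R (f x \<ominus> d x) y \<oplus> lie_bracket R x (f y \<ominus> d y)"
    using x y cl[OF x] cl[OF y] by (simp add: lie_bracket_def) algebra
qed

end

section \<open>Opposite rings\<close>

text \<open>The case \<open>k = 3\<close> is obtained from the case \<open>k = 1\<close> by reversing the multiplication.\<close>

definition opposite_ring :: "('a, 'b) ring_scheme \<Rightarrow> ('a, 'b) ring_scheme" where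
  "opposite_ring A = A\<lparr>mult := \<lambda>x y. y \<otimes>\<^bsub>A\<^esub> x\<rparr>"

lemma opposite_ring_simps [simp]:
  "carrier (opposite_ring A) = carrier A"
  "x \<otimes>\<^bsub>opposite_ring A\<^esub> y = y \<otimes>\<^bsub>A\<^esub> x"
  "\<one>\<^bsub>opposite_ring A\<^esub> = \<one>\<^bsub>A\<^esub>"
  "\<zero>\<^bsub>opposite_ring A\<^esub> = \<zero>\<^bsub>A\<^esub>"
  "x \<oplus>\<^bsub>opposite_ring A\<^esub> y = x \<oplus>\<^bsub>A\<^esub> y"
  "x \<ominus>\<^bsub>opposite_ring A\<^esub> y = x \<ominus>\<^bsub>A\<^esub> y"
  by (simp_all add: opposite_ring_def a_minus_def a_inv_def)

lemma lie_bracket_opposite_ring [simp]: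
  "lie_bracket (opposite_ring A) x y = lie_bracket A y x"
  by (simp add: lie_bracket_def)

context ring
begin

lemma ring_opposite_ring: "ring (opposite_ring R)"
proof (rule ringI)
  show "abelian_group (opposite_ring R)"
  proof (rule abelian_groupI)
    fix x assume "x \<in> carrier (opposite_ring R)"
    then show "\<exists>y\<in>carrier (opposite_ring R). y \<oplus>\<^bsub>opposite_ring R\<^esub> x = \<zero>\<^bsub>opposite_ring R\<^esub>"
      by (intro bexI[of _ "\<ominus> x"]) (simp_all add: l_neg)
  qed (simp_all add: a_ac)
  show "Group.monoid (opposite_ring R)"
    by unfold_locales (auto simp: m_assoc)
qed (auto simp: l_distr r_distr)

lemma ring_center_opposite_ring: "ring_center (opposite_ring R) = ring_center R"
  by (auto simp: ring_center_iff ring.ring_center_iff[OF ring_opposite_ring])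

lemma ring_derivation_opposite_ring:
  "ring_derivation (opposite_ring R) d \<longleftrightarrow> ring_derivation R d"
  unfolding ring_derivation_def opposite_ring_simps
  by (intro conj_cong refl) (auto simp: a_comm Pi_iff)

lemma mult_lie_derivation_opposite_ring:
  "mult_lie_derivation (opposite_ring R) d \<longleftrightarrow> mult_lie_derivation R d"
  unfolding mult_lie_derivation_def opposite_ring_simps lie_bracket_opposite_ring
  by (intro conj_cong refl) (auto simp: a_comm Pi_iff)

lemma central_vanishing_on_brackets_opposite_ring:
  "central_vanishing_on_brackets (opposite_ring R) d \<longleftrightarrow> central_vanishing_on_brackets R d"
  by (auto simp: central_vanishing_on_brackets_def ring_center_opposite_ring)

lemma has_standard_form_opposite_ring:
  "has_standard_form (opposite_ring R) d \<longleftrightarrow> has_standard_form R d"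
  by (simp add: has_standard_form_def ring_derivation_opposite_ring
      central_vanishing_on_brackets_opposite_ring)

end

section \<open>Corner rings\<close>

context ring
begin

lemma corner_opposite_ring:
  "\<lbrakk>q \<in> carrier R; X \<subseteq> carrier R\<rbrakk> \<Longrightarrow> corner (opposite_ring R) q X = corner R q X"
  unfolding corner_def by (intro image_cong) (auto simp: m_assoc)

lemma corner_ring_opposite_ring:
  "q \<in> carrier R \<Longrightarrow> corner_ring (opposite_ring R) q = opposite_ring (corner_ring R q)"
  using corner_opposite_ring[of q "carrier R"]
  by (simp add: corner_ring_def opposite_ring_def)

lemma ring_corner_ring:
  assumes q: "q \<in> carrier R" "q \<otimes> q = q"
  shows "ring (corner_ring R q)"
proof -
  have q1: "q \<otimes> (q \<otimes> x) = q \<otimes> x" if "x \<in> carrier R" for x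
    using q that by (metis m_assoc)
  have C: "x \<in> carrier (corner_ring R q) \<longleftrightarrow> x \<in> carrier R \<and> q \<otimes> x = x \<and> x \<otimes> q = x" for x
    using q by (auto simp: corner_ring_def corner_def image_iff q1 m_assoc)
      (metis)
  have s: "x \<otimes>\<^bsub>corner_ring R q\<^esub> y = x \<otimes> y" "x \<oplus>\<^bsub>corner_ring R q\<^esub> y = x \<oplus> y"
    "\<zero>\<^bsub>corner_ring R q\<^esub> = \<zero>" "\<one>\<^bsub>corner_ring R q\<^esub> = q" for x y
    by (simp_all add: corner_ring_def)
  show ?thesis
  proof (rule ringI)
    show "abelian_group (corner_ring R q)"
    proof (rule abelian_groupI)
      fix x assume "x \<in> carrier (corner_ring R q)"
      then show "\<exists>y\<in>carrier (corner_ring R q). y \<oplus>\<^bsub>corner_ring R q\<^esub> x = \<zero>\<^bsub>corner_ring R q\<^esub>"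
        using q by (intro bexI[of _ "\<ominus> x"]) (auto simp: C s l_neg l_minus r_minus)
    qed (use q in \<open>auto simp: C s a_ac l_distr r_distr\<close>)
    show "Group.monoid (corner_ring R q)"
      using q by unfold_locales (auto simp: C s m_assoc q1, metis m_assoc)
  qed (auto simp: C s l_distr r_distr)
qed

lemma carrier_corner_ring_iff:
  assumes q: "q \<in> carrier R" "q \<otimes> q = q"
  shows "x \<in> carrier (corner_ring R q) \<longleftrightarrow> x \<in> carrier R \<and> q \<otimes> x \<otimes> q = x"
proof -
  have "q \<otimes> (q \<otimes> x \<otimes> q) \<otimes> q = q \<otimes> x \<otimes> q" if "x \<in> carrier R" for x
    using q that by (metis m_assoc m_closed)
  then show ?thesis using q by (auto simp: corner_ring_def corner_def image_iff intro: bexI[of _ x])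
qed

lemma corner_ring_simps [simp]:
  "x \<otimes>\<^bsub>corner_ring R q\<^esub> y = x \<otimes> y" "x \<oplus>\<^bsub>corner_ring R q\<^esub> y = x \<oplus> y"
  "\<zero>\<^bsub>corner_ring R q\<^esub> = \<zero>" "\<one>\<^bsub>corner_ring R q\<^esub> = q"
  by (simp_all add: corner_ring_def)

text \<open>The additive inverse of a ring record depends on its carrier, so this needs an argument.\<close>

lemma lie_bracket_corner_ring:
  assumes q: "q \<in> carrier R" "q \<otimes> q = q"
    and x: "x \<in> carrier (corner_ring R q)" and y: "y \<in> carrier (corner_ring R q)"
  shows "lie_bracket (corner_ring R q) x y = lie_bracket R x y"
proof -
  interpret C: ring "corner_ring R q" using q by (rule ring_corner_ring)
  have yx: "y \<otimes> x \<in> carrier (corner_ring R q)" using C.m_closed[OF y x] by simp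
  have sub: "z \<in> carrier (corner_ring R q) \<Longrightarrow> z \<in> carrier R" for z
    using q by (simp add: carrier_corner_ring_iff)
  have "\<ominus>\<^bsub>corner_ring R q\<^esub> (y \<otimes> x) = \<ominus> (y \<otimes> x)"
    using C.l_neg[OF yx] sub[OF yx] sub[OF C.a_inv_closed[OF yx]]
    by (simp add: minus_equality)
  then show ?thesis by (simp add: lie_bracket_def C.minus_eq minus_eq)
qed

end

section \<open>Rings with a triangular Peirce decomposition\<close>

locale triangular_peirce = ring T for T (structure) +
  fixes e f
  assumes e_closed [simp, intro]: "e \<in> carrier T"
    and f_closed [simp, intro]: "f \<in> carrier T"
    and e_plus_f: "e \<oplus> f = \<one>"
    and e_idem: "e \<otimes> e = e"
    and lower_zero: "x \<in> carrier T \<Longrightarrow> f \<otimes> x \<otimes> e = \<zero>"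
begin

text \<open>The components of \<open>x\<close> in the upper corner \<open>AA = e T e\<close>, the off-diagonal block
  \<open>NN = e T f\<close> and the lower corner \<open>BB = f T f\<close>. With the simplification rules below, an identity
  between elements of \<open>T\<close> is checked component by component (\<open>peirce_eqI\<close>).\<close>

definition pe where "pe x = e \<otimes> x \<otimes> e"
definition pn where "pn x = e \<otimes> x \<otimes> f"
definition pf where "pf x = f \<otimes> x \<otimes> f"
definition AA where "AA = {x \<in> carrier T. pe x = x}"
definition NN where "NN = {x \<in> carrier T. pn x = x}"
definition BB where "BB = {x \<in> carrier T. pf x = x}"

lemma f_e: "f \<otimes> e = \<zero>"
  using lower_zero[of \<one>] by simp

lemma e_f: "e \<otimes> f = \<zero>"
proof -
  have "e \<otimes> (e \<oplus> f) = e" by (simp add: e_plus_f)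
  then show ?thesis by (simp add: r_distr e_idem)
qed

lemma f_idem: "f \<otimes> f = f"
proof -
  have "(e \<oplus> f) \<otimes> f = f" by (simp add: e_plus_f)
  then show ?thesis by (simp add: l_distr e_f)
qed

lemma idem_absorb:
  assumes "x \<in> carrier T"
  shows "e \<otimes> (e \<otimes> x) = e \<otimes> x" "f \<otimes> (f \<otimes> x) = f \<otimes> x"
    "e \<otimes> (f \<otimes> x) = \<zero>" "f \<otimes> (e \<otimes> x) = \<zero>" "f \<otimes> (x \<otimes> e) = \<zero>"
proof -
  show "f \<otimes> (x \<otimes> e) = \<zero>" using lower_zero[OF assms] assms by (simp add: m_assoc)
qed (use assms in \<open>simp_all add: m_assoc[symmetric] e_idem f_idem e_f f_e\<close>)

lemma proj_closed [simp, intro]: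
  assumes "x \<in> carrier T"
  shows "pe x \<in> carrier T" "pn x \<in> carrier T" "pf x \<in> carrier T"
  using assms by (simp_all add: pe_def pn_def pf_def)

lemma proj_proj [simp]:
  assumes "x \<in> carrier T"
  shows "pe (pe x) = pe x" "pe (pn x) = \<zero>" "pe (pf x) = \<zero>"
    "pn (pe x) = \<zero>" "pn (pn x) = pn x" "pn (pf x) = \<zero>"
    "pf (pe x) = \<zero>" "pf (pn x) = \<zero>" "pf (pf x) = pf x"
  using assms by (simp_all add: pe_def pn_def pf_def m_assoc e_idem f_idem e_f f_e idem_absorb)

lemma proj_add [simp]:
  assumes "x \<in> carrier T" "y \<in> carrier T"
  shows "pe (x \<oplus> y) = pe x \<oplus> pe y" "pn (x \<oplus> y) = pn x \<oplus> pn y" "pf (x \<oplus> y) = pf x \<oplus> pf y"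
  using assms by (simp_all add: pe_def pn_def pf_def l_distr r_distr)

lemma proj_neg [simp]:
  assumes "x \<in> carrier T"
  shows "pe (\<ominus> x) = \<ominus> pe x" "pn (\<ominus> x) = \<ominus> pn x" "pf (\<ominus> x) = \<ominus> pf x"
  using assms by (simp_all add: pe_def pn_def pf_def l_minus r_minus)

lemma proj_minus [simp]:
  assumes "x \<in> carrier T" "y \<in> carrier T"
  shows "pe (x \<ominus> y) = pe x \<ominus> pe y" "pn (x \<ominus> y) = pn x \<ominus> pn y" "pf (x \<ominus> y) = pf x \<ominus> pf y"
  using assms by (simp_all add: minus_eq)

lemma proj_unit [simp]:
  "pe e = e" "pn e = \<zero>" "pf e = \<zero>" "pe f = \<zero>" "pn f = \<zero>" "pf f = f"
  "pe \<zero> = \<zero>" "pn \<zero> = \<zero>" "pf \<zero> = \<zero>"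
  by (simp_all add: pe_def pn_def pf_def m_assoc e_idem f_idem e_f f_e)

lemma peirce_decomposition:
  assumes x: "x \<in> carrier T"
  shows "pe x \<oplus> (pn x \<oplus> pf x) = x"
proof -
  have "x = (e \<oplus> f) \<otimes> x \<otimes> (e \<oplus> f)" using x by (simp add: e_plus_f)
  also have "\<dots> = pe x \<oplus> (pn x \<oplus> pf x)"
    using x lower_zero[OF x]
    by (simp add: pe_def pn_def pf_def l_distr r_distr a_ac)
  finally show ?thesis ..
qed

lemma peirce_eqI:
  assumes "x \<in> carrier T" "y \<in> carrier T" "pe x = pe y" "pn x = pn y" "pf x = pf y"
  shows "x = y"
  by (metis assms peirce_decomposition)

lemma proj_mult [simp]:
  assumes x: "x \<in> carrier T" and y: "y \<in> carrier T"
  shows "pe (x \<otimes> y) = pe x \<otimes> pe y" "pf (x \<otimes> y) = pf x \<otimes> pf y"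
    "pn (x \<otimes> y) = pe x \<otimes> pn y \<oplus> pn x \<otimes> pf y"
proof -
  have split: "x \<otimes> y = x \<otimes> e \<otimes> y \<oplus> x \<otimes> f \<otimes> y"
  proof -
    have "x \<otimes> y = x \<otimes> (e \<oplus> f) \<otimes> y" using x by (simp add: e_plus_f)
    then show ?thesis using x y by (simp add: l_distr r_distr)
  qed
  have ye: "f \<otimes> (y \<otimes> e) = \<zero>" and xe: "\<And>z. z \<in> carrier T \<Longrightarrow> f \<otimes> (x \<otimes> (e \<otimes> z)) = \<zero>"
    using idem_absorb(5)[OF y] lower_zero[OF x] x by (simp_all add: m_assoc[symmetric])
  show "pe (x \<otimes> y) = pe x \<otimes> pe y" "pf (x \<otimes> y) = pf x \<otimes> pf y"
    "pn (x \<otimes> y) = pe x \<otimes> pn y \<oplus> pn x \<otimes> pf y"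
    using x y ye xe
    by (simp_all add: split pe_def pn_def pf_def l_distr r_distr m_assoc idem_absorb)
qed

lemma proj_bracket [simp]:
  assumes x: "x \<in> carrier T" and y: "y \<in> carrier T"
  shows "pe (lie_bracket T x y) = lie_bracket T (pe x) (pe y)"
    "pf (lie_bracket T x y) = lie_bracket T (pf x) (pf y)"
    "pn (lie_bracket T x y) =
      (pe x \<otimes> pn y \<oplus> pn x \<otimes> pf y) \<ominus> (pe y \<otimes> pn x \<oplus> pn y \<otimes> pf x)"
  using x y by (simp_all add: lie_bracket_def)

lemma bracket_zero [simp]:
  assumes "x \<in> carrier T"
  shows "lie_bracket T x \<zero> = \<zero>" "lie_bracket T \<zero> x = \<zero>"
  using assms by (simp_all add: lie_bracket_def minus_eq)

lemma proj_in [simp, intro]: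
  assumes "x \<in> carrier T"
  shows "pe x \<in> AA" "pn x \<in> NN" "pf x \<in> BB"
  using assms by (simp_all add: AA_def NN_def BB_def)

lemma proj_AA: "x \<in> AA \<Longrightarrow> pe x = x" "x \<in> AA \<Longrightarrow> pn x = \<zero>" "x \<in> AA \<Longrightarrow> pf x = \<zero>"
  using proj_proj[of x] by (auto simp: AA_def)

lemma proj_NN: "x \<in> NN \<Longrightarrow> pe x = \<zero>" "x \<in> NN \<Longrightarrow> pn x = x" "x \<in> NN \<Longrightarrow> pf x = \<zero>"
  using proj_proj[of x] by (auto simp: NN_def)

lemma proj_BB: "x \<in> BB \<Longrightarrow> pe x = \<zero>" "x \<in> BB \<Longrightarrow> pn x = \<zero>" "x \<in> BB \<Longrightarrow> pf x = x"
  using proj_proj[of x] by (auto simp: BB_def)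

lemma in_carrier:
  "x \<in> AA \<Longrightarrow> x \<in> carrier T" "x \<in> NN \<Longrightarrow> x \<in> carrier T" "x \<in> BB \<Longrightarrow> x \<in> carrier T"
  by (simp_all add: AA_def NN_def BB_def)

lemma unit_act:
  assumes "n \<in> NN"
  shows "e \<otimes> n = n" "n \<otimes> f = n"
proof -
  have n: "n \<in> carrier T" "e \<otimes> n \<otimes> f = n" using assms by (auto simp: NN_def pn_def)
  have "e \<otimes> (e \<otimes> n \<otimes> f) = e \<otimes> n \<otimes> f"
    using n(1) by (simp add: m_assoc idem_absorb)
  then show "e \<otimes> n = n" unfolding n(2) .
  have "e \<otimes> n \<otimes> f \<otimes> f = e \<otimes> n \<otimes> f"
    using n(1) by (simp add: m_assoc f_idem)
  then show "n \<otimes> f = n" unfolding n(2) .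
qed

lemma NN_I: "\<lbrakk>x \<in> carrier T; pn x = x\<rbrakk> \<Longrightarrow> x \<in> NN"
  by (simp add: NN_def)

lemma peirce_mult:
  assumes n: "n \<in> NN"
  shows "a \<in> AA \<Longrightarrow> a \<otimes> n \<in> NN" "b \<in> BB \<Longrightarrow> n \<otimes> b \<in> NN"
proof -
  assume a: "a \<in> AA"
  show "a \<otimes> n \<in> NN"
    by (rule NN_I) (simp_all add: in_carrier(1)[OF a] in_carrier(2)[OF n] proj_AA[OF a] proj_NN[OF n])
next
  assume b: "b \<in> BB"
  show "n \<otimes> b \<in> NN"
    by (rule NN_I) (simp_all add: in_carrier(3)[OF b] in_carrier(2)[OF n] proj_BB[OF b] proj_NN[OF n])
qed

lemma block_closed:
  "\<lbrakk>x \<in> AA; y \<in> AA\<rbrakk> \<Longrightarrow> x \<oplus> y \<in> AA" "\<lbrakk>x \<in> AA; y \<in> AA\<rbrakk> \<Longrightarrow> x \<ominus> y \<in> AA"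
  "\<lbrakk>x \<in> AA; y \<in> AA\<rbrakk> \<Longrightarrow> x \<otimes> y \<in> AA"
  "\<lbrakk>x \<in> NN; y \<in> NN\<rbrakk> \<Longrightarrow> x \<oplus> y \<in> NN" "x \<in> NN \<Longrightarrow> \<ominus> x \<in> NN"
  "\<lbrakk>x \<in> BB; y \<in> BB\<rbrakk> \<Longrightarrow> x \<oplus> y \<in> BB" "\<lbrakk>x \<in> BB; y \<in> BB\<rbrakk> \<Longrightarrow> x \<ominus> y \<in> BB"
  "\<lbrakk>x \<in> BB; y \<in> BB\<rbrakk> \<Longrightarrow> x \<otimes> y \<in> BB"
  by (simp_all add: AA_def NN_def BB_def)

lemma center_act: "\<lbrakk>z \<in> ring_center T; n \<in> NN\<rbrakk> \<Longrightarrow> n \<otimes> pf z = pe z \<otimes> n"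
proof -
  assume z: "z \<in> ring_center T" and n: "n \<in> NN"
  have zc: "z \<in> carrier T" and nc: "n \<in> carrier T"
    using z n by (auto simp: ring_center_def in_carrier)
  have "pn (z \<otimes> n) = pn (n \<otimes> z)" using z nc by (simp add: ring_center_iff)
  then show ?thesis using zc nc by (simp add: proj_NN[OF n])
qed

text \<open>For \<open>e = Q\<^sub>1\<close> in a triangular 3-matrix ring this is the ideal \<open>S\<^sub>1\<close>. It is the obstruction to
  faithfulness of the right action on \<open>NN\<close>, and hence to uniqueness of central lifts from the upper
  corner.\<close>

definition off_annihilator where "off_annihilator = {s \<in> BB. \<forall>n \<in> NN. n \<otimes> s = \<zero>}"

text \<open>In fact \<open>off_annihilator\<close> is a two-sided ideal: \<open>s x\<close> and \<open>x s\<close> only depend on the lower component of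
  \<open>x\<close>, since \<open>NN s = 0\<close>.\<close>

lemma off_annihilator_bracket:
  assumes s: "s \<in> off_annihilator" and x: "x \<in> carrier T"
  shows "lie_bracket T s x \<in> off_annihilator" "lie_bracket T x s \<in> off_annihilator"
proof -
  have sB: "s \<in> BB" and sc: "s \<in> carrier T" and s0: "\<And>n. n \<in> NN \<Longrightarrow> n \<otimes> s = \<zero>"
    using s by (auto simp: off_annihilator_def in_carrier)
  have n1: "n \<otimes> (s \<otimes> pf x) = \<zero>" "n \<otimes> (pf x \<otimes> s) = \<zero>" if n: "n \<in> NN" for n
    using s0[OF n] s0[OF peirce_mult(2)[OF n proj_in(3)[OF x]]] x sc n
    by (simp_all add: m_assoc[symmetric] in_carrier)
  have "lie_bracket T s x = lie_bracket T s (pf x)"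
    by (rule peirce_eqI) (simp_all add: x sc proj_BB[OF sB] s0 minus_eq)
  moreover have "lie_bracket T x s = lie_bracket T (pf x) s"
    by (rule peirce_eqI) (simp_all add: x sc proj_BB[OF sB] s0 minus_eq)
  moreover have "lie_bracket T s (pf x) \<in> BB" "lie_bracket T (pf x) s \<in> BB"
    unfolding lie_bracket_def by (intro block_closed sB proj_in x)+
  moreover have "n \<otimes> lie_bracket T s (pf x) = \<zero>" "n \<otimes> lie_bracket T (pf x) s = \<zero>" if "n \<in> NN" for n
    using n1[OF that] in_carrier(2)[OF that] x sc
    by (simp_all add: lie_bracket_def minus_eq r_distr r_minus)
  ultimately show "lie_bracket T s x \<in> off_annihilator" "lie_bracket T x s \<in> off_annihilator" by (auto simp: off_annihilator_def)
qed

end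

section \<open>Multiplicative Lie derivations of a triangular ring\<close>

context triangular_peirce
begin

text \<open>This identity ties bracket-compatible maps to the Peirce decomposition: it makes the projection
  to the off-diagonal block a bracket.\<close>

lemma bracket_e:
  assumes x: "x \<in> carrier T"
  shows "lie_bracket T e x = pn x"
proof -
  have "e \<otimes> pe x = pe x" "pe x \<otimes> e = pe x"
    using x by (simp_all add: pe_def m_assoc e_idem idem_absorb)
  then have "lie_bracket T e (pe x) = \<zero>"
    using x by (simp add: lie_bracket_def minus_eq r_neg)
  then show ?thesis
    using x by - (rule peirce_eqI, simp_all add: unit_act minus_eq)
qed

lemma bracket_NN:
  assumes x: "x \<in> carrier T" and n: "n \<in> NN"
  shows "lie_bracket T x n = pe x \<otimes> n \<ominus> n \<otimes> pf x"
  by (rule peirce_eqI)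
    (use x in_carrier(2)[OF n] in \<open>simp_all add: proj_NN[OF n] minus_eq\<close>)

lemma bracket_NN_closed:
  assumes x: "x \<in> carrier T" and n: "n \<in> NN"
  shows "lie_bracket T x n \<in> NN"
  using x in_carrier(2)[OF n]
  by (intro NN_I) (simp_all add: bracket_NN[OF x n] proj_NN[OF n])

end

text \<open>Every multiplicative Lie derivation differs by an inner derivation from one that satisfies
  \<open>phi_e\<close>; see \<open>lie_derivation_decomposition\<close> below.\<close>

locale normalized_lie_derivation = triangular_peirce +
  fixes \<phi>
  assumes lie: "mult_lie_derivation T \<phi>"
    and phi_e: "pn (\<phi> e) = \<zero>"
begin

lemma phi_closed [simp, intro]: "x \<in> carrier T \<Longrightarrow> \<phi> x \<in> carrier T"
  using lie by (auto simp: mult_lie_derivation_def)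

lemma phi_bracket:
  "\<lbrakk>x \<in> carrier T; y \<in> carrier T\<rbrakk> \<Longrightarrow>
    \<phi> (lie_bracket T x y) = lie_bracket T (\<phi> x) y \<oplus> lie_bracket T x (\<phi> y)"
  using lie by (auto simp: mult_lie_derivation_def)

lemma phi_zero [simp]: "\<phi> \<zero> = \<zero>"
  using phi_bracket[of \<zero> \<zero>] by simp

text \<open>Apply \<open>\<phi>\<close> to \<open>pn x = [e, x]\<close> and compare components. Doing so once more with \<open>pn x\<close> in place
  of \<open>x\<close> shows that all components of \<open>[\<phi> e, x]\<close> vanish.\<close>

lemma
  assumes x: "x \<in> carrier T"
  shows phi_pn: "\<phi> (pn x) = pn (\<phi> x)"
    and phi_e_central: "lie_bracket T (\<phi> e) x = \<zero>"
proof -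
  define u where "u = \<phi> e"
  have u: "u \<in> carrier T" "pn u = \<zero>" by (auto simp: u_def phi_e)
  have eq: "\<phi> (pn y) = lie_bracket T u y \<oplus> pn (\<phi> y)" if y: "y \<in> carrier T" for y
    using phi_bracket[of e y] y by (simp add: bracket_e u_def)
  have pe0: "pe (\<phi> (pn y)) = lie_bracket T (pe u) (pe y)"
    and pf0: "pf (\<phi> (pn y)) = lie_bracket T (pf u) (pf y)"
    and pn0: "pn (\<phi> (pn y)) = (pe u \<otimes> pn y \<ominus> pn y \<otimes> pf u) \<oplus> pn (\<phi> y)" if y: "y \<in> carrier T" for y
    using y u by (simp_all add: eq)
  have pe1: "pe (\<phi> (pn x)) = \<zero>" and pf1: "pf (\<phi> (pn x)) = \<zero>"
    using pe0[of "pn x"] pf0[of "pn x"] x u by simp_all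
  have cl: "pe u \<otimes> pn x \<ominus> pn x \<otimes> pf u \<in> carrier T" "pn (\<phi> (pn x)) \<in> carrier T" using x u by simp_all
  have pn1: "pe u \<otimes> pn x \<ominus> pn x \<otimes> pf u = \<zero>"
    using pn0[of "pn x"] x cl by simp
  show c: "lie_bracket T (\<phi> e) x = \<zero>"
    unfolding u_def[symmetric]
    by (rule peirce_eqI)
      (use x u pe0[OF x, symmetric] pf0[OF x, symmetric] pe1 pf1 pn1 in simp_all)
  show "\<phi> (pn x) = pn (\<phi> x)" using eq[OF x] c x by (simp add: u_def)
qed

lemma phi_NN:
  assumes n: "n \<in> NN" shows "\<phi> n \<in> NN"
  using phi_pn[of n] in_carrier(2)[OF n] proj_NN(2)[OF n] proj_in(2)[of "\<phi> n"] by simp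

text \<open>The bracket \<open>[x, n] = pe x n - n pf x\<close> does not involve the off-diagonal component of \<open>x\<close>, and
  the same holds for the two brackets in the image; all product rules for \<open>\<phi>\<close> on \<open>NN\<close> are special
  cases.\<close>

lemma phi_act:
  assumes x: "x \<in> carrier T" and n: "n \<in> NN"
  shows "\<phi> (pe x \<otimes> n \<ominus> n \<otimes> pf x) =
    (pe (\<phi> x) \<otimes> n \<ominus> n \<otimes> pf (\<phi> x)) \<oplus> (pe x \<otimes> \<phi> n \<ominus> \<phi> n \<otimes> pf x)"
  using phi_bracket[OF x in_carrier(2)[OF n]] x
  by (simp add: bracket_NN n phi_NN)

lemma phi_neg:
  assumes n: "n \<in> NN"
  shows "\<phi> (\<ominus> n) = \<ominus> \<phi> n"
proof -
  have nc: "n \<in> carrier T" "\<phi> n \<in> carrier T" using in_carrier(2) n phi_NN by auto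
  have *: "lie_bracket T y e = \<ominus> y" if "y \<in> NN" for y
    by (rule peirce_eqI)
      (use in_carrier(2)[OF that] bracket_e[of y] proj_NN(2)[OF that] unit_act[OF that] in \<open>simp_all add: proj_NN[OF that] minus_eq\<close>)
  have "lie_bracket T n (\<phi> e) = \<ominus> lie_bracket T (\<phi> e) n"
    unfolding lie_bracket_def using nc phi_closed[OF e_closed] by algebra
  then show ?thesis
    using phi_bracket[of n e] nc by (simp add: * n phi_NN phi_e_central)
qed

lemma minus_zero: "\<zero> \<ominus> \<zero> = \<zero>"
  by (simp add: minus_eq)

text \<open>The identity \<open>n + m = [e + n, f + m]\<close> turns a sum of off-diagonal elements into a single
  bracket.\<close>

lemma phi_add:
  assumes n: "n \<in> NN" and m: "m \<in> NN"
  shows "\<phi> (n \<oplus> m) = \<phi> n \<oplus> \<phi> m"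
proof -
  have c: "n \<in> carrier T" "m \<in> carrier T" "\<phi> n \<in> carrier T" "\<phi> m \<in> carrier T"
    using in_carrier(2) n m phi_NN by auto
  \<comment> \<open>The diagonal components of \<open>P\<close> and \<open>Q\<close> enter only through the brackets \<open>[P, m]\<close> and
    \<open>[n, Q]\<close>, and \<open>phi_act\<close> shows that both vanish.\<close>
  define P where "P = \<phi> (e \<oplus> n)"
  define Q where "Q = \<phi> (f \<oplus> m)"
  have PQ: "P \<in> carrier T" "Q \<in> carrier T" using c by (auto simp: P_def Q_def)
  have pnP: "pn P = \<phi> n" "pn Q = \<phi> m"
    using phi_pn[of "e \<oplus> n"] phi_pn[of "f \<oplus> m"] c
    by (simp_all add: P_def Q_def proj_NN n m)
  have br: "lie_bracket T (e \<oplus> n) (f \<oplus> m) = n \<oplus> m"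
    by (rule peirce_eqI) (use c in \<open>simp_all add: proj_NN n m unit_act minus_eq a_ac\<close>)
  have "\<phi> (n \<oplus> m) = lie_bracket T P (f \<oplus> m) \<oplus> lie_bracket T (e \<oplus> n) Q"
    using phi_bracket[of "e \<oplus> n" "f \<oplus> m"] c by (simp add: br P_def Q_def)
  then have "pn (\<phi> (n \<oplus> m)) = pn (lie_bracket T P (f \<oplus> m)) \<oplus> pn (lie_bracket T (e \<oplus> n) Q)"
    using c PQ by simp
  moreover have "pn (\<phi> (n \<oplus> m)) = \<phi> (n \<oplus> m)"
    using phi_NN[OF block_closed(4)[OF n m]] by (rule proj_NN(2))
  ultimately have 1: "\<phi> (n \<oplus> m) =
      ((pe P \<otimes> m \<oplus> \<phi> n) \<ominus> m \<otimes> pf P) \<oplus> ((\<phi> m \<oplus> n \<otimes> pf Q) \<ominus> pe Q \<otimes> n)"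
    using c PQ by (simp add: pnP proj_NN n m unit_act phi_NN)
  have "\<phi> m = (pe P \<otimes> m \<ominus> m \<otimes> pf P) \<oplus> \<phi> m"
    using phi_act[of "e \<oplus> n" m] c by (simp add: P_def[symmetric] m n proj_NN unit_act phi_NN minus_eq)
  then have 2: "pe P \<otimes> m \<ominus> m \<otimes> pf P = \<zero>" using c PQ by simp
  have "\<ominus> \<phi> n = (pe Q \<otimes> n \<ominus> n \<otimes> pf Q) \<ominus> \<phi> n"
    using phi_act[of "f \<oplus> m" n] c by (simp add: Q_def[symmetric] m n proj_NN unit_act phi_NN minus_eq phi_neg)
  then have 3: "pe Q \<otimes> n \<ominus> n \<otimes> pf Q = \<zero>" using c PQ by (simp add: minus_eq)
  have "\<phi> (n \<oplus> m) = (\<phi> n \<oplus> \<phi> m) \<oplus> (pe P \<otimes> m \<ominus> m \<otimes> pf P) \<ominus> (pe Q \<otimes> n \<ominus> n \<otimes> pf Q)"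
    unfolding 1 using c proj_closed[OF PQ(1)] proj_closed[OF PQ(2)] by algebra
  then show ?thesis unfolding 2 3 using c by (simp add: minus_eq)
qed

lemma phi_left:
  assumes a: "a \<in> AA" and n: "n \<in> NN"
  shows "\<phi> (a \<otimes> n) = (pe (\<phi> a) \<otimes> n \<ominus> n \<otimes> pf (\<phi> a)) \<oplus> a \<otimes> \<phi> n"
  using phi_act[OF in_carrier(1)[OF a] n] in_carrier(1)[OF a] in_carrier(2)[OF n]
  by (simp add: proj_AA[OF a] minus_eq)

lemma phi_right:
  assumes b: "b \<in> BB" and n: "n \<in> NN"
  shows "\<phi> (n \<otimes> b) = (n \<otimes> pf (\<phi> b) \<ominus> pe (\<phi> b) \<otimes> n) \<oplus> \<phi> n \<otimes> b"
proof -
  have c: "b \<in> carrier T" "n \<in> carrier T" "\<phi> n \<in> carrier T" "\<phi> b \<in> carrier T" "n \<otimes> b \<in> NN"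
     "\<phi> (n \<otimes> b) \<in> carrier T"
    using in_carrier b n peirce_mult phi_NN by auto
  have "\<ominus> \<phi> (n \<otimes> b) = (pe (\<phi> b) \<otimes> n \<ominus> n \<otimes> pf (\<phi> b)) \<ominus> \<phi> n \<otimes> b"
    using phi_act[OF c(1) n] c by (simp add: proj_BB[OF b] minus_eq phi_neg)
  then have "\<ominus> (\<ominus> \<phi> (n \<otimes> b)) = \<ominus> ((pe (\<phi> b) \<otimes> n \<ominus> n \<otimes> pf (\<phi> b)) \<ominus> \<phi> n \<otimes> b)"
    by (rule arg_cong)
  moreover have "\<dots> = (n \<otimes> pf (\<phi> b) \<ominus> pe (\<phi> b) \<otimes> n) \<oplus> \<phi> n \<otimes> b"
    using c proj_closed[OF c(4)] by algebra
  ultimately show ?thesis using c by simp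
qed

text \<open>The two corners commute, so \<open>[\<phi> a, b] + [a, \<phi> b] = 0\<close>, and the two summands lie in different
  corners.\<close>

lemma phi_block_central:
  assumes a: "a \<in> AA" and b: "b \<in> BB"
  shows "a \<otimes> pe (\<phi> b) = pe (\<phi> b) \<otimes> a" "pf (\<phi> a) \<otimes> b = b \<otimes> pf (\<phi> a)"
proof -
  have c: "a \<in> carrier T" "b \<in> carrier T" using in_carrier a b by auto
  have "lie_bracket T a b = \<zero>"
    by (rule peirce_eqI) (use c in \<open>simp_all add: proj_AA[OF a] proj_BB[OF b] minus_eq\<close>)
  then have 0: "lie_bracket T (\<phi> a) b \<oplus> lie_bracket T a (\<phi> b) = \<zero>"
    using phi_bracket[OF c] by simp
  show "a \<otimes> pe (\<phi> b) = pe (\<phi> b) \<otimes> a"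
    using arg_cong[OF 0, of pe] c by (simp add: proj_AA[OF a] proj_BB[OF b] lie_bracket_def minus_eq_zero_iff minus_zero)
  show "pf (\<phi> a) \<otimes> b = b \<otimes> pf (\<phi> a)"
    using arg_cong[OF 0, of pf] c by (simp add: proj_AA[OF a] proj_BB[OF b] lie_bracket_def minus_eq_zero_iff minus_zero)
qed

end

section \<open>Splitting a multiplicative Lie derivation\<close>

text \<open>The lower idempotent is further split as \<open>f = q + q'\<close>, and the upper corner is required to act
  faithfully on \<open>e T q\<close> and on \<open>e T q'\<close> separately. For matrices with \<open>e = Q\<^sub>1\<close> these blocks are
  \<open>M\<^sub>1\<^sub>2\<close> and \<open>M\<^sub>1\<^sub>3\<close>.\<close>

locale split_triangular_peirce = triangular_peirce +
  fixes q q'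
  assumes q_closed [simp, intro]: "q \<in> carrier T" "q' \<in> carrier T"
    and q_plus_q': "q \<oplus> q' = f"
    and q_orth: "q \<otimes> q = q" "q' \<otimes> q' = q'" "q \<otimes> q' = \<zero>" "q' \<otimes> q = \<zero>"
    and faithful_q: "\<lbrakk>a \<in> carrier T; e \<otimes> a \<otimes> e = a; \<forall>x \<in> carrier T. a \<otimes> x \<otimes> q = \<zero>\<rbrakk> \<Longrightarrow> a = \<zero>"
    and faithful_q': "\<lbrakk>a \<in> carrier T; e \<otimes> a \<otimes> e = a; \<forall>x \<in> carrier T. a \<otimes> x \<otimes> q' = \<zero>\<rbrakk> \<Longrightarrow> a = \<zero>"
    and center_e: "corner T e (ring_center T) = ring_center (corner_ring T e)"
    and center_f: "corner T f (ring_center T) = ring_center (corner_ring T f)"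
begin

lemma q_BB: "q \<in> BB" "q' \<in> BB"
proof -
  have "(q \<oplus> q') \<otimes> q \<otimes> (q \<oplus> q') = q" "(q \<oplus> q') \<otimes> q' \<otimes> (q \<oplus> q') = q'"
    by (simp_all add: l_distr r_distr q_orth)
  then show "q \<in> BB" "q' \<in> BB" by (simp_all add: BB_def pf_def q_plus_q')
qed

lemma AA_NN_q:
  assumes a: "a \<in> AA" and x: "x \<in> carrier T" and p: "p \<in> BB"
  shows "a \<otimes> pn x \<otimes> p = a \<otimes> x \<otimes> p"
proof -
  have c: "a \<in> carrier T" "p \<in> carrier T" using a p in_carrier by auto
  have "e \<otimes> a \<otimes> e \<otimes> e = e \<otimes> a \<otimes> e" using c by (simp add: m_assoc e_idem)
  then have ae: "a \<otimes> e = a" using a by (simp add: AA_def pe_def)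
  have "f \<otimes> (f \<otimes> p \<otimes> f) = f \<otimes> p \<otimes> f" using c by (simp add: m_assoc idem_absorb)
  then have fp: "f \<otimes> p = p" using p by (simp add: BB_def pf_def)
  have "a \<otimes> pn x \<otimes> p = (a \<otimes> e) \<otimes> x \<otimes> (f \<otimes> p)" using c x by (simp add: pn_def m_assoc)
  then show ?thesis by (simp only: ae fp)
qed

lemma faithful_NN_q:
  assumes a: "a \<in> AA"
  shows "(\<And>n. n \<in> NN \<Longrightarrow> a \<otimes> n \<otimes> q = \<zero>) \<Longrightarrow> a = \<zero>"
    and "(\<And>n. n \<in> NN \<Longrightarrow> a \<otimes> n \<otimes> q' = \<zero>) \<Longrightarrow> a = \<zero>"
proof -
  have ac: "a \<in> carrier T" "e \<otimes> a \<otimes> e = a" using a by (auto simp: AA_def pe_def)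
  show "a = \<zero>" if *: "\<And>n. n \<in> NN \<Longrightarrow> a \<otimes> n \<otimes> q = \<zero>"
  proof (rule faithful_q[OF ac], rule ballI)
    fix x assume x: "x \<in> carrier T"
    show "a \<otimes> x \<otimes> q = \<zero>"
      using *[OF proj_in(2)[OF x]] AA_NN_q[OF a x q_BB(1)] by simp
  qed
  show "a = \<zero>" if *: "\<And>n. n \<in> NN \<Longrightarrow> a \<otimes> n \<otimes> q' = \<zero>"
  proof (rule faithful_q'[OF ac], rule ballI)
    fix x assume x: "x \<in> carrier T"
    show "a \<otimes> x \<otimes> q' = \<zero>"
      using *[OF proj_in(2)[OF x]] AA_NN_q[OF a x q_BB(2)] by simp
  qed
qed

lemma faithful_NN:
  assumes a: "a \<in> AA" "a' \<in> AA" and eq: "\<And>n. n \<in> NN \<Longrightarrow> a \<otimes> n = a' \<otimes> n"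
  shows "a = a'"
proof -
  have c: "a \<in> carrier T" "a' \<in> carrier T" using a in_carrier by auto
  have "a \<ominus> a' = \<zero>"
    by (rule faithful_NN_q(1)[OF block_closed(2)[OF a]])
      (use c in \<open>simp add: in_carrier minus_eq l_distr l_minus eq r_neg\<close>)
  then show ?thesis using c by (simp add: minus_eq_zero_iff)
qed

lemma carrier_corner_e: "carrier (corner_ring T e) = AA"
  by (auto simp: carrier_corner_ring_iff e_idem AA_def pe_def)

lemma carrier_corner_f: "carrier (corner_ring T f) = BB"
  by (auto simp: carrier_corner_ring_iff f_idem BB_def pf_def)

lemma lift_center_e:
  assumes a: "a \<in> AA" and comm: "\<And>x. x \<in> AA \<Longrightarrow> a \<otimes> x = x \<otimes> a"
  shows "\<exists>z \<in> ring_center T. pe z = a"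
proof -
  interpret C: ring "corner_ring T e" by (rule ring_corner_ring) (auto simp: e_idem)
  have "a \<in> corner T e (ring_center T)"
    unfolding center_e C.ring_center_iff using a comm by (simp add: carrier_corner_e)
  then show ?thesis by (auto simp: corner_def pe_def)
qed

lemma center_corner_f: "c \<in> ring_center (corner_ring T f) \<Longrightarrow> \<exists>z \<in> ring_center T. pf z = c"
  unfolding center_f[symmetric] by (auto simp: corner_def pf_def)

lemma lift_center_f:
  assumes b: "b \<in> BB" and comm: "\<And>x. x \<in> BB \<Longrightarrow> b \<otimes> x = x \<otimes> b"
  shows "\<exists>z \<in> ring_center T. pf z = b"
proof -
  interpret C: ring "corner_ring T f" by (rule ring_corner_ring) (auto simp: f_idem)
  show ?thesis
    by (rule center_corner_f) (use b comm in \<open>simp add: C.ring_center_iff carrier_corner_f\<close>)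
qed

lemma pn_center: "z \<in> ring_center T \<Longrightarrow> pn z = \<zero>"
  using bracket_e[of z] by (auto simp: ring_center_iff lie_bracket_def minus_eq r_neg)

text \<open>If \<open>y\<close> commutes with \<open>NN\<close>, faithfulness makes \<open>pe y\<close> central in the upper corner. Lift it to a
  central \<open>z\<close>; then \<open>y - z\<close> lies in the lower corner and still commutes with \<open>NN\<close>, so it
  annihilates \<open>NN\<close>.\<close>

lemma centralizer_NN:
  assumes y: "y \<in> carrier T" and yn: "pn y = \<zero>"
    and comm: "\<And>n. n \<in> NN \<Longrightarrow> pe y \<otimes> n = n \<otimes> pf y"
  shows "\<exists>z s. z \<in> ring_center T \<and> s \<in> off_annihilator \<and> y = z \<oplus> s"
proof -
  \<comment> \<open>\<open>pe y\<close> acts on \<open>NN\<close> like right multiplication by \<open>pf y\<close>, which commutes with left actions.\<close>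
  have ya: "pe y \<otimes> a = a \<otimes> pe y" if a: "a \<in> AA" for a
  proof (rule faithful_NN)
    fix n assume n: "n \<in> NN"
    have c: "a \<in> carrier T" "n \<in> carrier T" using a n in_carrier by auto
    have "pe y \<otimes> a \<otimes> n = pe y \<otimes> (a \<otimes> n)" using c y by (simp add: m_assoc)
    also have "\<dots> = a \<otimes> (n \<otimes> pf y)"
      using c y comm[OF peirce_mult(1)[OF n a]] by (simp add: m_assoc)
    also have "\<dots> = a \<otimes> pe y \<otimes> n"
      using c y comm[OF n] by (simp add: m_assoc)
    finally show "pe y \<otimes> a \<otimes> n = a \<otimes> pe y \<otimes> n" .
  qed (use y a in \<open>auto intro: block_closed\<close>)
  obtain z where z: "z \<in> ring_center T" "pe z = pe y"
    using lift_center_e[OF proj_in(1)[OF y] ya] by auto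
  have zc: "z \<in> carrier T" using z by (simp add: ring_center_def)
  have s: "y \<ominus> z \<in> off_annihilator"
    unfolding off_annihilator_def BB_def
  proof (intro CollectI conjI ballI)
    show "y \<ominus> z \<in> carrier T" using y zc by simp
    show sB: "pf (y \<ominus> z) = y \<ominus> z"
      by (rule peirce_eqI) (use y zc yn pn_center[OF z(1)] z(2) in \<open>simp_all add: minus_eq r_neg\<close>)
    fix n assume n: "n \<in> NN"
    have nc: "n \<in> carrier T" using n in_carrier by auto
    have "n \<otimes> (y \<ominus> z) = n \<otimes> pf (y \<ominus> z)" by (simp only: sB)
    also have "\<dots> = n \<otimes> pf y \<ominus> n \<otimes> pf z"
      using y zc nc by (simp add: minus_eq r_distr r_minus)
    also have "\<dots> = \<zero>"
      using y zc nc by (simp add: comm[OF n, symmetric] center_act[OF z(1) n] z(2) minus_eq r_neg)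
    finally show "n \<otimes> (y \<ominus> z) = \<zero>" .
  qed
  have "y = z \<oplus> (y \<ominus> z)" using y zc by algebra
  with z s show ?thesis by blast
qed

end

locale normalized_split_lie_derivation = split_triangular_peirce + normalized_lie_derivation +
  assumes standard_f: "\<forall>\<psi>. mult_lie_derivation (corner_ring T f) \<psi> \<longrightarrow>
    has_standard_form (corner_ring T f) \<psi>"
begin

text \<open>The component of \<open>\<phi> a\<close> in the lower corner is the lower half of a central element; removing
  that element leaves a map determined by the action on the off-diagonal block.\<close>

lemma upper_derivation:
  obtains d where "\<And>a. a \<in> AA \<Longrightarrow> d a \<in> AA"
    "\<And>a n. \<lbrakk>a \<in> AA; n \<in> NN\<rbrakk> \<Longrightarrow> \<phi> (a \<otimes> n) = d a \<otimes> n \<oplus> a \<otimes> \<phi> n"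
    "\<And>a a'. \<lbrakk>a \<in> AA; a' \<in> AA\<rbrakk> \<Longrightarrow> d (a \<oplus> a') = d a \<oplus> d a'"
    "\<And>a a'. \<lbrakk>a \<in> AA; a' \<in> AA\<rbrakk> \<Longrightarrow> d (a \<otimes> a') = d a \<otimes> a' \<oplus> a \<otimes> d a'"
proof -
  have "\<exists>z \<in> ring_center T. pf z = pf (\<phi> a)" if a: "a \<in> AA" for a
    using phi_block_central(2)[OF a] in_carrier(1)[OF a] by (intro lift_center_f) auto
  then obtain z where z: "\<And>a. a \<in> AA \<Longrightarrow> z a \<in> ring_center T" "\<And>a. a \<in> AA \<Longrightarrow> pf (z a) = pf (\<phi> a)"
    by metis
  then have zc: "z a \<in> carrier T" if "a \<in> AA" for a using that by (auto simp: ring_center_def)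
  define d where "d a = pe (\<phi> a) \<ominus> pe (z a)" for a
  have dA: "d a \<in> AA" if "a \<in> AA" for a
    using that zc in_carrier by (auto simp: d_def intro!: block_closed)
  have act: "d a \<otimes> n = \<phi> (a \<otimes> n) \<ominus> a \<otimes> \<phi> n" if a: "a \<in> AA" and n: "n \<in> NN" for a n
  proof -
    have c: "a \<in> carrier T" "n \<in> carrier T" "\<phi> n \<in> carrier T" "pe (\<phi> a) \<in> carrier T" "pe (z a) \<in> carrier T"
      using a n zc in_carrier by auto
    have zn: "n \<otimes> pf (\<phi> a) = pe (z a) \<otimes> n" using center_act[OF z(1)[OF a] n] z(2)[OF a] by simp
    show ?thesis unfolding phi_left[OF a n] d_def zn using c by algebra
  qed
  have act': "\<phi> (a \<otimes> n) = d a \<otimes> n \<oplus> a \<otimes> \<phi> n" if a: "a \<in> AA" and n: "n \<in> NN" for a n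
  proof -
    have "\<phi> (a \<otimes> n) \<in> carrier T" "a \<otimes> \<phi> n \<in> carrier T" using a n in_carrier by auto
    then show ?thesis unfolding act[OF a n] by algebra
  qed
  have add: "d (a \<oplus> a') = d a \<oplus> d a'" if a: "a \<in> AA" "a' \<in> AA" for a a'
  proof (rule faithful_NN)
    fix n assume n: "n \<in> NN"
    have c: "a \<in> carrier T" "a' \<in> carrier T" "n \<in> carrier T" "\<phi> n \<in> carrier T"
      "d a \<in> carrier T" "d a' \<in> carrier T" "\<phi> (a \<otimes> n) \<in> carrier T" "\<phi> (a' \<otimes> n) \<in> carrier T"
      using a n dA in_carrier by auto
    have "d (a \<oplus> a') \<otimes> n = \<phi> (a \<otimes> n \<oplus> a' \<otimes> n) \<ominus> (a \<otimes> \<phi> n \<oplus> a' \<otimes> \<phi> n)"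
      using c a by (simp add: act n block_closed l_distr)
    also have "\<dots> = (\<phi> (a \<otimes> n) \<oplus> \<phi> (a' \<otimes> n)) \<ominus> (a \<otimes> \<phi> n \<oplus> a' \<otimes> \<phi> n)"
      using a n by (simp add: phi_add peirce_mult)
    also have "\<dots> = (\<phi> (a \<otimes> n) \<ominus> a \<otimes> \<phi> n) \<oplus> (\<phi> (a' \<otimes> n) \<ominus> a' \<otimes> \<phi> n)"
      using c by algebra
    also have "\<dots> = (d a \<oplus> d a') \<otimes> n" using c a n by (simp add: l_distr act)
    finally show "d (a \<oplus> a') \<otimes> n = (d a \<oplus> d a') \<otimes> n" .
  qed (use a dA in \<open>auto intro: block_closed\<close>)
  have mult: "d (a \<otimes> a') = d a \<otimes> a' \<oplus> a \<otimes> d a'" if a: "a \<in> AA" "a' \<in> AA" for a a'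
  proof (rule faithful_NN)
    fix n assume n: "n \<in> NN"
    have c: "a \<in> carrier T" "a' \<in> carrier T" "n \<in> carrier T" "\<phi> n \<in> carrier T"
      "d a \<in> carrier T" "d a' \<in> carrier T" "\<phi> (a' \<otimes> n) \<in> carrier T" "\<phi> (a \<otimes> (a' \<otimes> n)) \<in> carrier T"
      using a n dA in_carrier by auto
    have "(d a \<otimes> a' \<oplus> a \<otimes> d a') \<otimes> n = d a \<otimes> (a' \<otimes> n) \<oplus> a \<otimes> (d a' \<otimes> n)"
      using c by (simp add: l_distr m_assoc)
    also have "\<dots> = (\<phi> (a \<otimes> (a' \<otimes> n)) \<ominus> a \<otimes> \<phi> (a' \<otimes> n)) \<oplus> a \<otimes> (\<phi> (a' \<otimes> n) \<ominus> a' \<otimes> \<phi> n)"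
      using a n by (simp add: act peirce_mult)
    also have "\<dots> = \<phi> (a \<otimes> (a' \<otimes> n)) \<ominus> a \<otimes> (a' \<otimes> \<phi> n)"
      using c by algebra
    also have "\<dots> = d (a \<otimes> a') \<otimes> n" using c a n by (simp add: act block_closed m_assoc)
    finally show "d (a \<otimes> a') \<otimes> n = (d a \<otimes> a' \<oplus> a \<otimes> d a') \<otimes> n" ..
  qed (use a dA in \<open>auto intro: block_closed\<close>)
  show thesis by (rule that[of d]) (use dA act' add mult in auto)
qed

lemma standard_lower:
  obtains d g where "\<And>b. b \<in> BB \<Longrightarrow> d b \<in> BB"
    "\<And>b b'. \<lbrakk>b \<in> BB; b' \<in> BB\<rbrakk> \<Longrightarrow> d (b \<oplus> b') = d b \<oplus> d b'"
    "\<And>b b'. \<lbrakk>b \<in> BB; b' \<in> BB\<rbrakk> \<Longrightarrow> d (b \<otimes> b') = d b \<otimes> b' \<oplus> b \<otimes> d b'"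
    "\<And>b. b \<in> BB \<Longrightarrow> g b \<in> ring_center (corner_ring T f)"
    "\<And>b. b \<in> BB \<Longrightarrow> pf (\<phi> b) = d b \<oplus> g b"
proof -
  have br: "lie_bracket (corner_ring T f) x y = lie_bracket T x y" if "x \<in> BB" "y \<in> BB" for x y
    using that by (intro lie_bracket_corner_ring) (auto simp: f_idem carrier_corner_f)
  have "mult_lie_derivation (corner_ring T f) (\<lambda>b. pf (\<phi> b))"
    unfolding mult_lie_derivation_def carrier_corner_f
  proof (intro conjI ballI)
    show "(\<lambda>b. pf (\<phi> b)) \<in> BB \<rightarrow> BB" using in_carrier by auto
    fix x y assume x: "x \<in> BB" and y: "y \<in> BB"
    have c: "x \<in> carrier T" "y \<in> carrier T" using x y in_carrier by auto
    show "pf (\<phi> (lie_bracket (corner_ring T f) x y)) =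
        lie_bracket (corner_ring T f) (pf (\<phi> x)) y \<oplus>\<^bsub>corner_ring T f\<^esub>
        lie_bracket (corner_ring T f) x (pf (\<phi> y))"
      using c by (simp add: br x y phi_bracket proj_BB(3)[OF x] proj_BB(3)[OF y])
  qed
  with standard_f obtain d g where
    "ring_derivation (corner_ring T f) d" "central_vanishing_on_brackets (corner_ring T f) g"
    "\<forall>b \<in> BB. pf (\<phi> b) = d b \<oplus> g b"
    unfolding has_standard_form_def carrier_corner_f corner_ring_simps by metis
  then show thesis
    by (intro that[of d g]) (auto simp: ring_derivation_def central_vanishing_on_brackets_def carrier_corner_f)
qed

text \<open>Off-diagonally \<open>\<phi>\<close> obeys the Leibniz rule of \<open>d\<close> up to left multiplication by some \<open>h b\<close> in
  the upper corner. The defect satisfies \<open>h (b b') n = h b n b' + h b' n b\<close>; choosing one of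
  the factors to be \<open>q\<close> or \<open>q'\<close> and multiplying by the other idempotent kills \<open>h\<close>, because both
  \<open>e T q\<close> and \<open>e T q'\<close> are faithful.\<close>

lemma lower_derivation:
  obtains d where "\<And>b. b \<in> BB \<Longrightarrow> d b \<in> BB"
    "\<And>b b'. \<lbrakk>b \<in> BB; b' \<in> BB\<rbrakk> \<Longrightarrow> d (b \<oplus> b') = d b \<oplus> d b'"
    "\<And>b b'. \<lbrakk>b \<in> BB; b' \<in> BB\<rbrakk> \<Longrightarrow> d (b \<otimes> b') = d b \<otimes> b' \<oplus> b \<otimes> d b'"
    "\<And>b n. \<lbrakk>b \<in> BB; n \<in> NN\<rbrakk> \<Longrightarrow> \<phi> (n \<otimes> b) = \<phi> n \<otimes> b \<oplus> n \<otimes> d b"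
proof -
  obtain d g where d: "\<And>b. b \<in> BB \<Longrightarrow> d b \<in> BB"
    and d_add: "\<And>b b'. \<lbrakk>b \<in> BB; b' \<in> BB\<rbrakk> \<Longrightarrow> d (b \<oplus> b') = d b \<oplus> d b'"
    and d_mult: "\<And>b b'. \<lbrakk>b \<in> BB; b' \<in> BB\<rbrakk> \<Longrightarrow> d (b \<otimes> b') = d b \<otimes> b' \<oplus> b \<otimes> d b'"
    and g: "\<And>b. b \<in> BB \<Longrightarrow> g b \<in> ring_center (corner_ring T f)"
    and pf_phi: "\<And>b. b \<in> BB \<Longrightarrow> pf (\<phi> b) = d b \<oplus> g b"
    using standard_lower by blast
  obtain z where z: "\<And>b. b \<in> BB \<Longrightarrow> z b \<in> ring_center T" "\<And>b. b \<in> BB \<Longrightarrow> pf (z b) = g b"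
    using center_corner_f[OF g] by metis
  then have zc: "z b \<in> carrier T" if "b \<in> BB" for b using that by (auto simp: ring_center_def)
  define h where "h b = pe (z b) \<ominus> pe (\<phi> b)" for b
  have hA: "h b \<in> AA" if "b \<in> BB" for b
    unfolding h_def by (intro block_closed(2) proj_in(1) zc phi_closed in_carrier(3) that)
  have act: "h b \<otimes> n = \<phi> (n \<otimes> b) \<ominus> (\<phi> n \<otimes> b \<oplus> n \<otimes> d b)" if b: "b \<in> BB" and n: "n \<in> NN" for b n
  proof -
    have c: "b \<in> carrier T" "n \<in> carrier T" "\<phi> n \<in> carrier T" "pe (\<phi> b) \<in> carrier T"
       "pe (z b) \<in> carrier T" "pf (z b) \<in> carrier T" "d b \<in> carrier T"
      using b n zc in_carrier d by auto
    have zn: "n \<otimes> pf (z b) = pe (z b) \<otimes> n" using center_act[OF z(1)[OF b] n] .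
    have "\<phi> (n \<otimes> b) = ((n \<otimes> d b \<oplus> n \<otimes> pf (z b)) \<ominus> pe (\<phi> b) \<otimes> n) \<oplus> \<phi> n \<otimes> b"
      using c by (simp add: phi_right[OF b n] pf_phi[OF b] z(2)[OF b, symmetric] r_distr)
    then show ?thesis unfolding h_def zn using c by algebra
  qed
  have mult: "h (b \<otimes> b') \<otimes> n = h b \<otimes> n \<otimes> b' \<oplus> h b' \<otimes> n \<otimes> b"
    if b: "b \<in> BB" "b' \<in> BB" and n: "n \<in> NN" for b b' n
  proof -
    have c: "b \<in> carrier T" "b' \<in> carrier T" "n \<in> carrier T" "\<phi> n \<in> carrier T"
      "d b \<in> carrier T" "d b' \<in> carrier T" "h b \<in> carrier T" "h b' \<in> carrier T"
      "\<phi> (n \<otimes> b) \<in> carrier T" "\<phi> (n \<otimes> b \<otimes> b') \<in> carrier T"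
      using b n d hA in_carrier by auto
    have 1: "h b' \<otimes> n \<otimes> b = \<phi> (n \<otimes> b \<otimes> b') \<ominus> (\<phi> (n \<otimes> b) \<otimes> b' \<oplus> n \<otimes> b \<otimes> d b')"
      using c act[OF b(2) peirce_mult(2)[OF n b(1)]] by (simp add: m_assoc)
    have 2: "h b \<otimes> n \<otimes> b' = (\<phi> (n \<otimes> b) \<ominus> (\<phi> n \<otimes> b \<oplus> n \<otimes> d b)) \<otimes> b'"
      by (simp add: act b n)
    have "h (b \<otimes> b') \<otimes> n = \<phi> (n \<otimes> b \<otimes> b') \<ominus> (\<phi> n \<otimes> (b \<otimes> b') \<oplus> n \<otimes> (d b \<otimes> b' \<oplus> b \<otimes> d b'))"
      using c b n by (simp add: act block_closed d_mult m_assoc)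
    also have "\<dots> = h b \<otimes> n \<otimes> b' \<oplus> h b' \<otimes> n \<otimes> b"
      unfolding 1 2 using c by algebra
    finally show ?thesis .
  qed
  have hc: "h b \<in> carrier T" if "b \<in> BB" for b using hA[OF that] in_carrier by auto
  have nc: "n \<in> carrier T" if "n \<in> NN" for n using that in_carrier by auto
  have hq: "h q = \<zero>"
  proof (rule faithful_NN_q(2)[OF hA[OF q_BB(1)]])
    fix n assume n: "n \<in> NN"
    have "h q \<otimes> n \<otimes> q' = (h q \<otimes> n \<otimes> q \<oplus> h q \<otimes> n \<otimes> q) \<otimes> q'"
      using mult[OF q_BB(1) q_BB(1) n] by (simp add: q_orth)
    then show "h q \<otimes> n \<otimes> q' = \<zero>"
      using hc[OF q_BB(1)] nc[OF n] by (simp add: l_distr m_assoc q_orth)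
  qed
  have hq': "h q' = \<zero>"
  proof (rule faithful_NN_q(1)[OF hA[OF q_BB(2)]])
    fix n assume n: "n \<in> NN"
    have "h q' \<otimes> n \<otimes> q = (h q' \<otimes> n \<otimes> q' \<oplus> h q' \<otimes> n \<otimes> q') \<otimes> q"
      using mult[OF q_BB(2) q_BB(2) n] by (simp add: q_orth)
    then show "h q' \<otimes> n \<otimes> q = \<zero>"
      using hc[OF q_BB(2)] nc[OF n] by (simp add: l_distr m_assoc q_orth)
  qed
  have hbq: "h (b \<otimes> q) = \<zero>" if b: "b \<in> BB" for b
  proof (rule faithful_NN_q(2)[OF hA[OF block_closed(8)[OF b q_BB(1)]]])
    fix n assume n: "n \<in> NN"
    show "h (b \<otimes> q) \<otimes> n \<otimes> q' = \<zero>"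
      using hc[OF b] nc[OF n] in_carrier(3)[OF b]
      by (simp add: mult[OF b q_BB(1) n] hq l_distr m_assoc q_orth)
  qed
  have hbq': "h (b \<otimes> q') = \<zero>" if b: "b \<in> BB" for b
  proof (rule faithful_NN_q(1)[OF hA[OF block_closed(8)[OF b q_BB(2)]]])
    fix n assume n: "n \<in> NN"
    show "h (b \<otimes> q') \<otimes> n \<otimes> q = \<zero>"
      using hc[OF b] nc[OF n] in_carrier(3)[OF b]
      by (simp add: mult[OF b q_BB(2) n] hq' l_distr m_assoc q_orth)
  qed
  have d_act: "\<phi> (n \<otimes> b) = \<phi> n \<otimes> b \<oplus> n \<otimes> d b" if b: "b \<in> BB" and n: "n \<in> NN" for b n
  proof -
    have leibniz: "\<phi> (n \<otimes> b') = \<phi> n \<otimes> b' \<oplus> n \<otimes> d b'" if b': "b' \<in> BB" and "h b' = \<zero>" for b'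
    proof -
      have c: "\<phi> (n \<otimes> b') \<in> carrier T" "\<phi> n \<otimes> b' \<oplus> n \<otimes> d b' \<in> carrier T"
        using b' n d in_carrier by auto
      then show ?thesis
        using act[OF b' n] nc[OF n] that(2) minus_eq_zero_iff[OF c] by simp
    qed
    have bq: "b \<otimes> q \<in> BB" "b \<otimes> q' \<in> BB" using b q_BB block_closed by auto
    have c: "b \<in> carrier T" "n \<in> carrier T" "\<phi> n \<in> carrier T" "d (b \<otimes> q) \<in> carrier T" "d (b \<otimes> q') \<in> carrier T"
      using b n d bq in_carrier by auto
    have "b \<otimes> (q \<oplus> q') = b"
    proof -
      have "f \<otimes> b \<otimes> f \<otimes> f = f \<otimes> b \<otimes> f" using c by (simp add: m_assoc f_idem)
      then show ?thesis unfolding q_plus_q' using b by (simp add: BB_def pf_def)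
    qed
    then have b_eq: "b = b \<otimes> q \<oplus> b \<otimes> q'" using c by (simp add: r_distr)
    have "\<phi> (n \<otimes> b) = \<phi> (n \<otimes> (b \<otimes> q) \<oplus> n \<otimes> (b \<otimes> q'))"
      using c by (subst b_eq) (simp add: r_distr)
    also have "\<dots> = \<phi> (n \<otimes> (b \<otimes> q)) \<oplus> \<phi> (n \<otimes> (b \<otimes> q'))"
      using n bq by (simp add: phi_add peirce_mult)
    also have "\<dots> = (\<phi> n \<otimes> (b \<otimes> q) \<oplus> n \<otimes> d (b \<otimes> q)) \<oplus> (\<phi> n \<otimes> (b \<otimes> q') \<oplus> n \<otimes> d (b \<otimes> q'))"
      by (simp only: leibniz[OF bq(1) hbq[OF b]] leibniz[OF bq(2) hbq'[OF b]])
    also have "\<dots> = \<phi> n \<otimes> (b \<otimes> q \<oplus> b \<otimes> q') \<oplus> n \<otimes> (d (b \<otimes> q) \<oplus> d (b \<otimes> q'))"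
      using c q_closed by algebra
    also have "\<dots> = \<phi> n \<otimes> b \<oplus> n \<otimes> d b"
      unfolding d_add[OF bq, symmetric] b_eq[symmetric] ..
    finally show ?thesis .
  qed
  show thesis by (rule that[of d]) (use d d_add d_mult d_act in auto)
qed

text \<open>The two corner derivations and the restriction of \<open>\<phi>\<close> to \<open>NN\<close> assemble to \<open>\<delta>\<close>. The difference
  \<open>\<tau> = \<phi> - \<delta>\<close> has values in the centralizer of \<open>NN\<close>.\<close>

lemma normalized_decomposition:
  "\<exists>\<delta> \<gamma> \<xi>. ring_derivation T \<delta> \<and> central_vanishing_on_brackets T \<gamma> \<and> mult_lie_derivation T \<xi> \<and>
    \<xi> \<in> carrier T \<rightarrow> off_annihilator \<and> (\<forall>x \<in> carrier T. \<phi> x = \<delta> x \<oplus> \<gamma> x \<oplus> \<xi> x)"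
proof -
  obtain dA where dA: "\<And>a. a \<in> AA \<Longrightarrow> dA a \<in> AA"
    and dA_act: "\<And>a n. \<lbrakk>a \<in> AA; n \<in> NN\<rbrakk> \<Longrightarrow> \<phi> (a \<otimes> n) = dA a \<otimes> n \<oplus> a \<otimes> \<phi> n"
    and dA_add: "\<And>a a'. \<lbrakk>a \<in> AA; a' \<in> AA\<rbrakk> \<Longrightarrow> dA (a \<oplus> a') = dA a \<oplus> dA a'"
    and dA_mult: "\<And>a a'. \<lbrakk>a \<in> AA; a' \<in> AA\<rbrakk> \<Longrightarrow> dA (a \<otimes> a') = dA a \<otimes> a' \<oplus> a \<otimes> dA a'"
    using upper_derivation by blast
  obtain dB where dB: "\<And>b. b \<in> BB \<Longrightarrow> dB b \<in> BB"
    and dB_add: "\<And>b b'. \<lbrakk>b \<in> BB; b' \<in> BB\<rbrakk> \<Longrightarrow> dB (b \<oplus> b') = dB b \<oplus> dB b'"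
    and dB_mult: "\<And>b b'. \<lbrakk>b \<in> BB; b' \<in> BB\<rbrakk> \<Longrightarrow> dB (b \<otimes> b') = dB b \<otimes> b' \<oplus> b \<otimes> dB b'"
    and dB_act: "\<And>b n. \<lbrakk>b \<in> BB; n \<in> NN\<rbrakk> \<Longrightarrow> \<phi> (n \<otimes> b) = \<phi> n \<otimes> b \<oplus> n \<otimes> dB b"
    using lower_derivation by blast
  define \<delta> where "\<delta> x = dA (pe x) \<oplus> (\<phi> (pn x) \<oplus> dB (pf x))" for x
  have c: "dA (pe x) \<in> carrier T" "\<phi> (pn x) \<in> carrier T" "dB (pf x) \<in> carrier T" "\<delta> x \<in> carrier T"
    if "x \<in> carrier T" for x
    using that dA dB in_carrier by (auto simp: \<delta>_def)
  have comp: "pe (\<delta> x) = dA (pe x)" "pn (\<delta> x) = \<phi> (pn x)" "pf (\<delta> x) = dB (pf x)" if x: "x \<in> carrier T" for x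
    using c[OF x] proj_AA[OF dA[OF proj_in(1)[OF x]]] proj_NN[OF phi_NN[OF proj_in(2)[OF x]]]
      proj_BB[OF dB[OF proj_in(3)[OF x]]]
    by (simp_all add: \<delta>_def)
  have der: "ring_derivation T \<delta>"
    unfolding ring_derivation_def
  proof (intro conjI ballI)
    show "\<delta> \<in> carrier T \<rightarrow> carrier T" using c by auto
    fix x y assume x: "x \<in> carrier T" and y: "y \<in> carrier T"
    show "\<delta> (x \<oplus> y) = \<delta> x \<oplus> \<delta> y"
      by (rule peirce_eqI) (use x y c[OF x] c[OF y] c[of "x \<oplus> y"] in \<open>simp_all add: comp dA_add dB_add phi_add\<close>)
    show "\<delta> (x \<otimes> y) = \<delta> x \<otimes> y \<oplus> x \<otimes> \<delta> y"
      by (rule peirce_eqI) (use x y c[OF x] c[OF y] c[of "x \<otimes> y"] in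
          \<open>simp_all add: comp dA_mult dB_mult phi_add peirce_mult dA_act dB_act a_ac\<close>)
  qed
  define \<tau> where "\<tau> x = \<phi> x \<ominus> \<delta> x" for x
  have \<tau>: "mult_lie_derivation T \<tau>"
    unfolding \<tau>_def[abs_def] using lie der by (rule mult_lie_derivation_diff)
  then have \<tau>c: "\<tau> x \<in> carrier T" if "x \<in> carrier T" for x using that by (auto simp: mult_lie_derivation_def)
  have \<tau>_br: "\<tau> (lie_bracket T x y) = lie_bracket T (\<tau> x) y \<oplus> lie_bracket T x (\<tau> y)"
    if "x \<in> carrier T" "y \<in> carrier T" for x y
    using \<tau> that by (simp add: mult_lie_derivation_def)
  have zero: "dA \<zero> = \<zero>" "dB \<zero> = \<zero>"
  proof -
    have "\<zero> \<in> AA" "\<zero> \<in> BB" by (simp_all add: AA_def BB_def)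
    then show "dA \<zero> = \<zero>" "dB \<zero> = \<zero>"
      using dA_add[of \<zero> \<zero>] dB_add[of \<zero> \<zero>] dA[of \<zero>] dB[of \<zero>] in_carrier by simp_all
  qed
  have \<tau>_NN: "\<tau> n = \<zero>" if n: "n \<in> NN" for n
    using in_carrier(2)[OF n] in_carrier(2)[OF phi_NN[OF n]]
    by (simp add: \<tau>_def \<delta>_def proj_NN[OF n] zero minus_eq r_neg)
  have split: "\<exists>z s. z \<in> ring_center T \<and> s \<in> off_annihilator \<and> \<tau> x = z \<oplus> s" if x: "x \<in> carrier T" for x
  proof (rule centralizer_NN[OF \<tau>c[OF x]])
    show "pn (\<tau> x) = \<zero>"
      using x c[OF x] by (simp add: \<tau>_def comp phi_pn minus_eq r_neg)
    fix n assume n: "n \<in> NN"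
    have "lie_bracket T (\<tau> x) n = \<zero>"
      using \<tau>_br[OF x in_carrier(2)[OF n]] x n \<tau>c[OF x] in_carrier(2)[OF n]
      by (simp add: \<tau>_NN bracket_NN_closed)
    then show "pe (\<tau> x) \<otimes> n = n \<otimes> pf (\<tau> x)"
      using \<tau>c[OF x] n in_carrier(2)[OF n] by (simp add: bracket_NN minus_eq_zero_iff)
  qed
  then obtain z s where zs: "\<And>x. x \<in> carrier T \<Longrightarrow> z x \<in> ring_center T \<and> s x \<in> off_annihilator \<and> \<tau> x = z x \<oplus> s x"
    by metis
  \<comment> \<open>The splitting of \<open>\<tau> x\<close> is not unique. Preferring \<open>\<gamma> x = 0\<close> where possible makes \<open>\<gamma>\<close>
    vanish on brackets, whose images under \<open>\<tau>\<close> lie in the annihilator.\<close>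
  define \<gamma> where "\<gamma> x = (if \<tau> x \<in> off_annihilator then \<zero> else z x)" for x
  define \<xi> where "\<xi> x = (if \<tau> x \<in> off_annihilator then \<tau> x else s x)" for x
  have ann_closed: "t \<in> carrier T" if "t \<in> off_annihilator" for t using that in_carrier by (auto simp: off_annihilator_def)
  have \<gamma>Z: "\<gamma> x \<in> ring_center T" and \<xi>S: "\<xi> x \<in> off_annihilator" and sum: "\<tau> x = \<gamma> x \<oplus> \<xi> x" if "x \<in> carrier T" for x
    using zs[OF that] \<tau>c[OF that] by (auto simp: \<gamma>_def \<xi>_def ring_center_iff)
  have \<gamma>c: "\<gamma> x \<in> carrier T" and \<xi>c: "\<xi> x \<in> carrier T" if "x \<in> carrier T" for x
    using \<gamma>Z[OF that] \<xi>S[OF that] ann_closed by (auto simp: ring_center_def)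
  have ann_add: "t \<oplus> t' \<in> off_annihilator" if "t \<in> off_annihilator" "t' \<in> off_annihilator" for t t'
    using that in_carrier by (auto simp: off_annihilator_def block_closed r_distr)
  have br_eq: "lie_bracket T (\<tau> x) y = lie_bracket T (\<xi> x) y" "lie_bracket T y (\<tau> x) = lie_bracket T y (\<xi> x)"
    if x: "x \<in> carrier T" and y: "y \<in> carrier T" for x y
  proof -
    have 0: "\<gamma> x \<otimes> y = y \<otimes> \<gamma> x" using \<gamma>Z[OF x] y by (simp add: ring_center_iff)
    show "lie_bracket T (\<tau> x) y = lie_bracket T (\<xi> x) y"
      unfolding sum[OF x] lie_bracket_def l_distr[OF \<gamma>c[OF x] \<xi>c[OF x] y] 0
      using \<gamma>c[OF x] \<xi>c[OF x] y by algebra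
    show "lie_bracket T y (\<tau> x) = lie_bracket T y (\<xi> x)"
      unfolding sum[OF x] lie_bracket_def l_distr[OF \<gamma>c[OF x] \<xi>c[OF x] y] 0
      using \<gamma>c[OF x] \<xi>c[OF x] y by algebra
  qed
  have \<tau>_br_\<xi>: "\<tau> (lie_bracket T x y) = lie_bracket T (\<xi> x) y \<oplus> lie_bracket T x (\<xi> y)"
    if "x \<in> carrier T" "y \<in> carrier T" for x y
    using that by (simp add: \<tau>_br br_eq)
  then have \<tau>_br_ann: "\<tau> (lie_bracket T x y) \<in> off_annihilator" if "x \<in> carrier T" "y \<in> carrier T" for x y
    using that by (simp add: ann_add off_annihilator_bracket \<xi>S)
  have "central_vanishing_on_brackets T \<gamma>"
    using \<gamma>Z \<tau>_br_ann by (auto simp: central_vanishing_on_brackets_def \<gamma>_def)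
  moreover have "mult_lie_derivation T \<xi>"
    unfolding mult_lie_derivation_def
  proof (intro conjI ballI)
    fix x y assume "x \<in> carrier T" "y \<in> carrier T"
    then show "\<xi> (lie_bracket T x y) = lie_bracket T (\<xi> x) y \<oplus> lie_bracket T x (\<xi> y)"
      using \<tau>_br_ann[of x y] \<tau>_br_\<xi>[of x y] by (simp add: \<xi>_def[of "lie_bracket T x y"])
  qed (use \<xi>c in auto)
  moreover have "\<phi> x = \<delta> x \<oplus> \<gamma> x \<oplus> \<xi> x" if x: "x \<in> carrier T" for x
  proof -
    have "\<phi> x = \<delta> x \<oplus> \<tau> x" unfolding \<tau>_def using c(4)[OF x] phi_closed[OF x] by algebra
    then show ?thesis using sum[OF x] c(4)[OF x] \<gamma>c[OF x] \<xi>c[OF x] by (simp add: a_assoc)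
  qed
  ultimately show ?thesis using der \<xi>S by blast
qed

end

context split_triangular_peirce
begin

lemma lie_derivation_decomposition:
  assumes std: "\<forall>\<psi>. mult_lie_derivation (corner_ring T f) \<psi> \<longrightarrow> has_standard_form (corner_ring T f) \<psi>"
    and lie: "mult_lie_derivation T \<phi>"
  shows "\<exists>\<delta> \<gamma> \<xi>. ring_derivation T \<delta> \<and> central_vanishing_on_brackets T \<gamma> \<and>
    mult_lie_derivation T \<xi> \<and> \<xi> \<in> carrier T \<rightarrow> off_annihilator \<and> (\<forall>x \<in> carrier T. \<phi> x = \<delta> x \<oplus> \<gamma> x \<oplus> \<xi> x)"
proof -
  have phi: "\<phi> x \<in> carrier T" if "x \<in> carrier T" for x
    using lie that by (auto simp: mult_lie_derivation_def)
  \<comment> \<open>\<open>[e, m] = m\<close> for \<open>m \<in> NN\<close>, so subtracting \<open>[x, m]\<close> removes \<open>pn (\<phi> e)\<close>.\<close>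
  define m where "m = pn (\<phi> e)"
  have m: "m \<in> NN" "m \<in> carrier T" by (auto simp: m_def phi)
  have inner: "ring_derivation T (\<lambda>x. lie_bracket T x m)" using m(2) by (rule inner_derivation)
  define \<phi>0 where "\<phi>0 x = \<phi> x \<ominus> lie_bracket T x m" for x
  interpret normalized_split_lie_derivation T e f q q' \<phi>0
  proof unfold_locales
    show "mult_lie_derivation T \<phi>0"
      unfolding \<phi>0_def[abs_def] using lie inner by (rule mult_lie_derivation_diff)
    show "pn (\<phi>0 e) = \<zero>"
      using m phi by (simp add: \<phi>0_def bracket_e proj_NN[OF m(1)] m_def[symmetric] minus_eq r_neg)
  qed (use std in auto)
  obtain \<delta> \<gamma> \<xi> where *: "ring_derivation T \<delta>" "central_vanishing_on_brackets T \<gamma>"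
    "mult_lie_derivation T \<xi>" "\<xi> \<in> carrier T \<rightarrow> off_annihilator" "\<forall>x \<in> carrier T. \<phi>0 x = \<delta> x \<oplus> \<gamma> x \<oplus> \<xi> x"
    using normalized_decomposition by blast
  have "\<phi> x = (\<delta> x \<oplus> lie_bracket T x m) \<oplus> \<gamma> x \<oplus> \<xi> x" if x: "x \<in> carrier T" for x
  proof -
    have c: "\<delta> x \<in> carrier T" "\<gamma> x \<in> carrier T" "\<xi> x \<in> carrier T" "lie_bracket T x m \<in> carrier T" "\<phi> x \<in> carrier T"
      using * x m phi by (auto simp: ring_derivation_def central_vanishing_on_brackets_def
          mult_lie_derivation_def ring_center_def Pi_iff)
    have "\<phi> x = \<phi>0 x \<oplus> lie_bracket T x m" unfolding \<phi>0_def using c by algebra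
    also have "\<dots> = (\<delta> x \<oplus> lie_bracket T x m) \<oplus> \<gamma> x \<oplus> \<xi> x"
      using *(5) x c by (simp add: a_ac)
    finally show ?thesis .
  qed
  moreover have "ring_derivation T (\<lambda>x. \<delta> x \<oplus> lie_bracket T x m)"
    using *(1) inner by (rule ring_derivation_add)
  ultimately show ?thesis using *(2-4) by blast
qed

end

section \<open>The triangular 3-matrix ring\<close>

lemma upper3_iff [simp]: "(i, j) \<in> upper3 \<longleftrightarrow> 1 \<le> i \<and> i \<le> j \<and> j \<le> 3"
  by (simp add: upper3_def)

lemma upper3_eq: "upper3 = {(1, 1), (1, 2), (1, 3), (2, 2), (2, 3), (3, 3)}"
proof -
  have "p \<in> {(1, 1), (1, 2), (1, 3), (2, 2), (2, 3), (3, 3)}" if "p \<in> upper3" for p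
  proof -
    obtain i j where p: "p = (i, j)" by fastforce
    with that have "1 \<le> i" "i \<le> j" "j \<le> 3" by simp_all
    then have "i \<in> {1, 2, 3}" "j \<in> {1, 2, 3}" by auto
    with that p show ?thesis by auto
  qed
  then show ?thesis by (auto simp: upper3_def)
qed

lemma interval3:
  "{1..1} = {1::nat}" "{1..2} = {1, 2::nat}" "{1..3} = {1, 2, 3::nat}"
  "{2..2} = {2::nat}" "{2..3} = {2, 3::nat}" "{3..3} = {3::nat}"
  by auto

lemma carrier_tri_ring: "carrier (tri_ring M \<mu>) = (\<Pi>\<^sub>E (i, j) \<in> upper3. carrier (M i j))"
  by (simp add: tri_ring_def)

lemma tri_ring_entry:
  "\<lbrakk>x \<in> carrier (tri_ring M \<mu>); 1 \<le> i; i \<le> j; j \<le> 3\<rbrakk> \<Longrightarrow> x (i, j) \<in> carrier (M i j)"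
  using PiE_mem[of x upper3 "\<lambda>(i, j). carrier (M i j)" "(i, j)"]
  by (simp add: carrier_tri_ring)

lemma tri_ring_eqI:
  assumes "x \<in> carrier (tri_ring M \<mu>)" "y \<in> carrier (tri_ring M \<mu>)"
    and "x (1, 1) = y (1, 1)" "x (1, 2) = y (1, 2)" "x (1, 3) = y (1, 3)"
    and "x (2, 2) = y (2, 2)" "x (2, 3) = y (2, 3)" "x (3, 3) = y (3, 3)"
  shows "x = y"
  using assms(1,2) unfolding carrier_tri_ring
  by (rule PiE_ext) (use assms(3-) in \<open>auto simp: upper3_eq\<close>)

lemma tri_ringI:
  assumes "\<And>i j. \<lbrakk>1 \<le> i; i \<le> j; j \<le> 3\<rbrakk> \<Longrightarrow> g i j \<in> carrier (M i j)"
  shows "(\<lambda>(i, j) \<in> upper3. g i j) \<in> carrier (tri_ring M \<mu>)"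
  unfolding carrier_tri_ring using assms by (auto simp: PiE_iff)

context triangular3
begin

lemma M_group: "\<lbrakk>1 \<le> i; i \<le> j; j \<le> 3\<rbrakk> \<Longrightarrow> abelian_group (M i j)"
  by (rule bimodule.axioms(3)[OF bimod])

lemma M_monoid: "\<lbrakk>1 \<le> i; i \<le> j; j \<le> 3\<rbrakk> \<Longrightarrow> abelian_monoid (M i j)"
  by (rule abelian_group.axioms(1)[OF M_group])

lemma mu_zero_left:
  assumes "1 \<le> i" "i \<le> j" "j \<le> k" "k \<le> 3" "b \<in> carrier (M j k)"
  shows "\<mu> i j k \<zero>\<^bsub>M i j\<^esub> b = \<zero>\<^bsub>M i k\<^esub>"
proof -
  interpret ij: abelian_group "M i j" by (rule M_group) (use assms in auto)
  interpret ik: abelian_group "M i k" by (rule M_group) (use assms in auto)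
  have "\<mu> i j k \<zero>\<^bsub>M i j\<^esub> b \<in> carrier (M i k)" using assms by (intro mu_closed) auto
  moreover have "\<mu> i j k (\<zero>\<^bsub>M i j\<^esub> \<oplus>\<^bsub>M i j\<^esub> \<zero>\<^bsub>M i j\<^esub>) b = \<mu> i j k \<zero>\<^bsub>M i j\<^esub> b \<oplus>\<^bsub>M i k\<^esub> \<mu> i j k \<zero>\<^bsub>M i j\<^esub> b"
    using assms by (intro mu_add_left) auto
  ultimately show ?thesis by simp
qed

lemma mu_zero_right:
  assumes "1 \<le> i" "i \<le> j" "j \<le> k" "k \<le> 3" "a \<in> carrier (M i j)"
  shows "\<mu> i j k a \<zero>\<^bsub>M j k\<^esub> = \<zero>\<^bsub>M i k\<^esub>"
proof -
  interpret jk: abelian_group "M j k" by (rule M_group) (use assms in auto)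
  interpret ik: abelian_group "M i k" by (rule M_group) (use assms in auto)
  have "\<mu> i j k a \<zero>\<^bsub>M j k\<^esub> \<in> carrier (M i k)" using assms by (intro mu_closed) auto
  moreover have "\<mu> i j k a (\<zero>\<^bsub>M j k\<^esub> \<oplus>\<^bsub>M j k\<^esub> \<zero>\<^bsub>M j k\<^esub>) = \<mu> i j k a \<zero>\<^bsub>M j k\<^esub> \<oplus>\<^bsub>M i k\<^esub> \<mu> i j k a \<zero>\<^bsub>M j k\<^esub>"
    using assms by (intro mu_add_right) auto
  ultimately show ?thesis by simp
qed

lemma M_one_closed: "\<lbrakk>1 \<le> i; i \<le> 3\<rbrakk> \<Longrightarrow> \<one>\<^bsub>M i i\<^esub> \<in> carrier (M i i)"
  using ring_R[of i] diag[of i] by (simp add: ring.is_monoid monoid.one_closed)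

lemma mu_one_left: "\<lbrakk>1 \<le> i; i \<le> j; j \<le> 3; m \<in> carrier (M i j)\<rbrakk> \<Longrightarrow> \<mu> i i j \<one>\<^bsub>M i i\<^esub> m = m"
  using bimodule.lact_one[OF bimod, of i j m] diag[of i] by simp

lemma mu_one_right: "\<lbrakk>1 \<le> i; i \<le> j; j \<le> 3; m \<in> carrier (M i j)\<rbrakk> \<Longrightarrow> \<mu> i j j m \<one>\<^bsub>M j j\<^esub> = m"
  using bimodule.ract_one[OF bimod, of i j m] diag[of j] by simp

text \<open>Among four indices \<open>i \<le> j \<le> k \<le> l\<close> from \<open>{1..3}\<close> two neighbours agree, so one of the three
  products is a ring action.\<close>

lemma mu_assoc:
  assumes ijkl: "1 \<le> i" "i \<le> j" "j \<le> k" "k \<le> l" "l \<le> 3"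
    and abc: "a \<in> carrier (M i j)" "b \<in> carrier (M j k)" "c \<in> carrier (M k l)"
  shows "\<mu> i k l (\<mu> i j k a b) c = \<mu> i j l a (\<mu> j k l b c)"
proof -
  consider "i = j" | "j = k" | "k = l" using ijkl by linarith
  then show ?thesis
  proof cases
    case 1
    then show ?thesis using assms diag[of i] by (simp add: mu_linear_left)
  next
    case 2
    then show ?thesis using assms diag[of j] by (simp add: mu_balanced)
  next
    case 3
    then show ?thesis using assms diag[of k] by (simp add: mu_linear_right)
  qed
qed

lemma tri_mult_entry:
  assumes x: "x \<in> carrier (tri_ring M \<mu>)" and y: "y \<in> carrier (tri_ring M \<mu>)"
  shows "(x \<otimes>\<^bsub>tri_ring M \<mu>\<^esub> y) (1, 1) = \<mu> 1 1 1 (x (1, 1)) (y (1, 1))"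
    "(x \<otimes>\<^bsub>tri_ring M \<mu>\<^esub> y) (2, 2) = \<mu> 2 2 2 (x (2, 2)) (y (2, 2))"
    "(x \<otimes>\<^bsub>tri_ring M \<mu>\<^esub> y) (3, 3) = \<mu> 3 3 3 (x (3, 3)) (y (3, 3))"
    "(x \<otimes>\<^bsub>tri_ring M \<mu>\<^esub> y) (1, 2) =
      \<mu> 1 1 2 (x (1, 1)) (y (1, 2)) \<oplus>\<^bsub>M 1 2\<^esub> \<mu> 1 2 2 (x (1, 2)) (y (2, 2))"
    "(x \<otimes>\<^bsub>tri_ring M \<mu>\<^esub> y) (2, 3) =
      \<mu> 2 2 3 (x (2, 2)) (y (2, 3)) \<oplus>\<^bsub>M 2 3\<^esub> \<mu> 2 3 3 (x (2, 3)) (y (3, 3))"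
    "(x \<otimes>\<^bsub>tri_ring M \<mu>\<^esub> y) (1, 3) =
      \<mu> 1 1 3 (x (1, 1)) (y (1, 3)) \<oplus>\<^bsub>M 1 3\<^esub>
      (\<mu> 1 2 3 (x (1, 2)) (y (2, 3)) \<oplus>\<^bsub>M 1 3\<^esub> \<mu> 1 3 3 (x (1, 3)) (y (3, 3)))"
proof -
  note cl = tri_ring_entry[OF x] tri_ring_entry[OF y] mu_closed
  have entry: "(x \<otimes>\<^bsub>tri_ring M \<mu>\<^esub> y) (i, k) = finsum (M i k) (\<lambda>j. \<mu> i j k (x (i, j)) (y (j, k))) {i..k}"
    if "1 \<le> i" "i \<le> k" "k \<le> 3" for i k
    using that by (simp add: tri_ring_def)
  interpret m11: abelian_group "M 1 1" by (rule M_group) auto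
  interpret m12: abelian_group "M 1 2" by (rule M_group) auto
  interpret m13: abelian_group "M 1 3" by (rule M_group) auto
  interpret m22: abelian_group "M 2 2" by (rule M_group) auto
  interpret m23: abelian_group "M 2 3" by (rule M_group) auto
  interpret m33: abelian_group "M 3 3" by (rule M_group) auto
  show "(x \<otimes>\<^bsub>tri_ring M \<mu>\<^esub> y) (1, 1) = \<mu> 1 1 1 (x (1, 1)) (y (1, 1))"
    "(x \<otimes>\<^bsub>tri_ring M \<mu>\<^esub> y) (2, 2) = \<mu> 2 2 2 (x (2, 2)) (y (2, 2))"
    "(x \<otimes>\<^bsub>tri_ring M \<mu>\<^esub> y) (3, 3) = \<mu> 3 3 3 (x (3, 3)) (y (3, 3))"
    "(x \<otimes>\<^bsub>tri_ring M \<mu>\<^esub> y) (1, 2) =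
      \<mu> 1 1 2 (x (1, 1)) (y (1, 2)) \<oplus>\<^bsub>M 1 2\<^esub> \<mu> 1 2 2 (x (1, 2)) (y (2, 2))"
    "(x \<otimes>\<^bsub>tri_ring M \<mu>\<^esub> y) (2, 3) =
      \<mu> 2 2 3 (x (2, 2)) (y (2, 3)) \<oplus>\<^bsub>M 2 3\<^esub> \<mu> 2 3 3 (x (2, 3)) (y (3, 3))"
    "(x \<otimes>\<^bsub>tri_ring M \<mu>\<^esub> y) (1, 3) =
      \<mu> 1 1 3 (x (1, 1)) (y (1, 3)) \<oplus>\<^bsub>M 1 3\<^esub>
      (\<mu> 1 2 3 (x (1, 2)) (y (2, 3)) \<oplus>\<^bsub>M 1 3\<^esub> \<mu> 1 3 3 (x (1, 3)) (y (3, 3)))"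
    by (simp_all add: entry interval3 cl Pi_iff del: One_nat_def)
qed

lemma tri_ring_simps:
  "\<lbrakk>1 \<le> i; i \<le> j; j \<le> 3\<rbrakk> \<Longrightarrow> (x \<oplus>\<^bsub>tri_ring M \<mu>\<^esub> y) (i, j) = x (i, j) \<oplus>\<^bsub>M i j\<^esub> y (i, j)"
  "\<lbrakk>1 \<le> i; i \<le> j; j \<le> 3\<rbrakk> \<Longrightarrow> \<zero>\<^bsub>tri_ring M \<mu>\<^esub> (i, j) = \<zero>\<^bsub>M i j\<^esub>"
  "\<lbrakk>1 \<le> i; i \<le> j; j \<le> 3\<rbrakk> \<Longrightarrow> \<one>\<^bsub>tri_ring M \<mu>\<^esub> (i, j) = (if i = j then \<one>\<^bsub>M i i\<^esub> else \<zero>\<^bsub>M i j\<^esub>)"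
  by (simp_all add: tri_ring_def)

lemmas M_add = abelian_monoid.a_closed[OF M_monoid] abelian_monoid.a_assoc[OF M_monoid]
  abelian_monoid.a_comm[OF M_monoid] abelian_monoid.a_lcomm[OF M_monoid]
lemmas M_zero = abelian_monoid.zero_closed[OF M_monoid] abelian_monoid.l_zero[OF M_monoid]
  abelian_monoid.r_zero[OF M_monoid]

lemma tri_closed:
  shows "\<lbrakk>x \<in> carrier (tri_ring M \<mu>); y \<in> carrier (tri_ring M \<mu>)\<rbrakk> \<Longrightarrow> x \<oplus>\<^bsub>tri_ring M \<mu>\<^esub> y \<in> carrier (tri_ring M \<mu>)"
    "\<lbrakk>x \<in> carrier (tri_ring M \<mu>); y \<in> carrier (tri_ring M \<mu>)\<rbrakk> \<Longrightarrow> x \<otimes>\<^bsub>tri_ring M \<mu>\<^esub> y \<in> carrier (tri_ring M \<mu>)"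
    "\<zero>\<^bsub>tri_ring M \<mu>\<^esub> \<in> carrier (tri_ring M \<mu>)" "\<one>\<^bsub>tri_ring M \<mu>\<^esub> \<in> carrier (tri_ring M \<mu>)"
proof -
  assume x: "x \<in> carrier (tri_ring M \<mu>)" and y: "y \<in> carrier (tri_ring M \<mu>)"
  have "(\<lambda>(i, j) \<in> upper3. x (i, j) \<oplus>\<^bsub>M i j\<^esub> y (i, j)) \<in> carrier (tri_ring M \<mu>)"
    by (rule tri_ringI) (simp add: M_add tri_ring_entry[OF x] tri_ring_entry[OF y])
  then show "x \<oplus>\<^bsub>tri_ring M \<mu>\<^esub> y \<in> carrier (tri_ring M \<mu>)" by (simp add: tri_ring_def)
  have "(\<lambda>(i, k) \<in> upper3. finsum (M i k) (\<lambda>j. \<mu> i j k (x (i, j)) (y (j, k))) {i..k}) \<in> carrier (tri_ring M \<mu>)"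
    by (rule tri_ringI, rule abelian_monoid.finsum_closed[OF M_monoid])
      (auto simp: mu_closed tri_ring_entry[OF x] tri_ring_entry[OF y])
  then show "x \<otimes>\<^bsub>tri_ring M \<mu>\<^esub> y \<in> carrier (tri_ring M \<mu>)" by (simp add: tri_ring_def)
next
  have "(\<lambda>(i, j) \<in> upper3. \<zero>\<^bsub>M i j\<^esub>) \<in> carrier (tri_ring M \<mu>)"
    by (rule tri_ringI) (simp add: M_zero)
  then show "\<zero>\<^bsub>tri_ring M \<mu>\<^esub> \<in> carrier (tri_ring M \<mu>)" by (simp add: tri_ring_def)
  have "(\<lambda>(i, j) \<in> upper3. if i = j then \<one>\<^bsub>M i i\<^esub> else \<zero>\<^bsub>M i j\<^esub>) \<in> carrier (tri_ring M \<mu>)"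
    by (rule tri_ringI) (simp add: M_zero M_one_closed)
  then show "\<one>\<^bsub>tri_ring M \<mu>\<^esub> \<in> carrier (tri_ring M \<mu>)" by (simp add: tri_ring_def)
qed

lemma ring_tri_ring: "ring (tri_ring M \<mu>)"
proof (rule ringI)
  show "abelian_group (tri_ring M \<mu>)"
  proof (rule abelian_groupI)
    fix x assume x: "x \<in> carrier (tri_ring M \<mu>)"
    define y where "y = (\<lambda>(i, j) \<in> upper3. \<ominus>\<^bsub>M i j\<^esub> x (i, j))"
    have y: "y \<in> carrier (tri_ring M \<mu>)"
      unfolding y_def by (rule tri_ringI) (simp add: abelian_group.a_inv_closed[OF M_group] tri_ring_entry[OF x])
    have "y \<oplus>\<^bsub>tri_ring M \<mu>\<^esub> x = \<zero>\<^bsub>tri_ring M \<mu>\<^esub>"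
      by (rule tri_ring_eqI[where M = M and \<mu> = \<mu>]) (use x y in \<open>simp_all add: tri_closed tri_ring_simps y_def tri_ring_entry
          abelian_group.l_neg[OF M_group]\<close>)
    with y show "\<exists>y\<in>carrier (tri_ring M \<mu>). y \<oplus>\<^bsub>tri_ring M \<mu>\<^esub> x = \<zero>\<^bsub>tri_ring M \<mu>\<^esub>" by blast
    show "\<zero>\<^bsub>tri_ring M \<mu>\<^esub> \<oplus>\<^bsub>tri_ring M \<mu>\<^esub> x = x"
      by (rule tri_ring_eqI[where M = M and \<mu> = \<mu>]) (use x in \<open>simp_all add: tri_closed tri_ring_simps tri_ring_entry M_zero\<close>)
    fix y assume y: "y \<in> carrier (tri_ring M \<mu>)"
    show "x \<oplus>\<^bsub>tri_ring M \<mu>\<^esub> y = y \<oplus>\<^bsub>tri_ring M \<mu>\<^esub> x"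
      by (rule tri_ring_eqI[where M = M and \<mu> = \<mu>]) (use x y in \<open>simp_all add: tri_closed tri_ring_simps tri_ring_entry M_add\<close>)
    fix z assume z: "z \<in> carrier (tri_ring M \<mu>)"
    show "x \<oplus>\<^bsub>tri_ring M \<mu>\<^esub> y \<oplus>\<^bsub>tri_ring M \<mu>\<^esub> z = x \<oplus>\<^bsub>tri_ring M \<mu>\<^esub> (y \<oplus>\<^bsub>tri_ring M \<mu>\<^esub> z)"
      by (rule tri_ring_eqI[where M = M and \<mu> = \<mu>]) (use x y z in \<open>simp_all add: tri_closed tri_ring_simps tri_ring_entry M_add\<close>)
  qed (auto simp: tri_closed)
  show "Group.monoid (tri_ring M \<mu>)"
  proof (rule monoidI)
    fix x assume x: "x \<in> carrier (tri_ring M \<mu>)"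
    show "\<one>\<^bsub>tri_ring M \<mu>\<^esub> \<otimes>\<^bsub>tri_ring M \<mu>\<^esub> x = x"
      by (rule tri_ring_eqI[where M = M and \<mu> = \<mu>]) (use x in \<open>simp_all add: tri_closed tri_mult_entry tri_ring_simps tri_ring_entry M_zero mu_one_left mu_zero_left del: One_nat_def\<close>)
    show "x \<otimes>\<^bsub>tri_ring M \<mu>\<^esub> \<one>\<^bsub>tri_ring M \<mu>\<^esub> = x"
      by (rule tri_ring_eqI[where M = M and \<mu> = \<mu>]) (use x in \<open>simp_all add: tri_closed tri_mult_entry tri_ring_simps tri_ring_entry M_zero mu_one_right mu_zero_right del: One_nat_def\<close>)
    fix y assume y: "y \<in> carrier (tri_ring M \<mu>)"
    fix z assume z: "z \<in> carrier (tri_ring M \<mu>)"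
    show "x \<otimes>\<^bsub>tri_ring M \<mu>\<^esub> y \<otimes>\<^bsub>tri_ring M \<mu>\<^esub> z = x \<otimes>\<^bsub>tri_ring M \<mu>\<^esub> (y \<otimes>\<^bsub>tri_ring M \<mu>\<^esub> z)"
      by (rule tri_ring_eqI[where M = M and \<mu> = \<mu>]) (use x y z in \<open>simp_all add: tri_closed tri_mult_entry tri_ring_entry M_add
          mu_add_left mu_add_right mu_closed mu_assoc del: One_nat_def\<close>)
  qed (auto simp: tri_closed)
  fix x y z assume x: "x \<in> carrier (tri_ring M \<mu>)" and y: "y \<in> carrier (tri_ring M \<mu>)" and z: "z \<in> carrier (tri_ring M \<mu>)"
  show "(x \<oplus>\<^bsub>tri_ring M \<mu>\<^esub> y) \<otimes>\<^bsub>tri_ring M \<mu>\<^esub> z = x \<otimes>\<^bsub>tri_ring M \<mu>\<^esub> z \<oplus>\<^bsub>tri_ring M \<mu>\<^esub> y \<otimes>\<^bsub>tri_ring M \<mu>\<^esub> z"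
    by (rule tri_ring_eqI[where M = M and \<mu> = \<mu>]) (use x y z in \<open>simp_all add: tri_closed tri_mult_entry tri_ring_simps tri_ring_entry M_add
          mu_add_left mu_closed del: One_nat_def\<close>)
  show "z \<otimes>\<^bsub>tri_ring M \<mu>\<^esub> (x \<oplus>\<^bsub>tri_ring M \<mu>\<^esub> y) = z \<otimes>\<^bsub>tri_ring M \<mu>\<^esub> x \<oplus>\<^bsub>tri_ring M \<mu>\<^esub> z \<otimes>\<^bsub>tri_ring M \<mu>\<^esub> y"
    by (rule tri_ring_eqI[where M = M and \<mu> = \<mu>]) (use x y z in \<open>simp_all add: tri_closed tri_mult_entry tri_ring_simps tri_ring_entry M_add
          mu_add_right mu_closed del: One_nat_def\<close>)
qed

end

section \<open>Diagonal idempotents and faithfulness\<close>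

definition tri_unit :: "(nat \<Rightarrow> nat \<Rightarrow> 'a ring) \<Rightarrow> nat \<Rightarrow> nat \<Rightarrow> 'a \<Rightarrow> nat \<times> nat \<Rightarrow> 'a" where
  "tri_unit M i j m = (\<lambda>(a, b) \<in> upper3. if a = i \<and> b = j then m else \<zero>\<^bsub>M a b\<^esub>)"

lemma tri_Q_unit: "tri_Q M l = tri_unit M l l \<one>\<^bsub>M l l\<^esub>"
  by (simp add: tri_Q_def tri_unit_def)

lemma tri_unit_entry:
  "\<lbrakk>1 \<le> a; a \<le> b; b \<le> 3\<rbrakk> \<Longrightarrow> tri_unit M i j m (a, b) = (if a = i \<and> b = j then m else \<zero>\<^bsub>M a b\<^esub>)"
  by (simp add: tri_unit_def)

context triangular3
begin

abbreviation T where "T \<equiv> tri_ring M \<mu>"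
abbreviation Q where "Q \<equiv> tri_Q M"

lemma tri_unit_closed: "\<lbrakk>1 \<le> i; i \<le> j; j \<le> 3; m \<in> carrier (M i j)\<rbrakk> \<Longrightarrow> tri_unit M i j m \<in> carrier T"
  unfolding tri_unit_def by (rule tri_ringI) (simp add: M_zero)

lemma Q_closed: "\<lbrakk>1 \<le> l; l \<le> 3\<rbrakk> \<Longrightarrow> Q l \<in> carrier T"
  by (simp add: tri_Q_unit tri_unit_closed M_one_closed)

lemma Q_entry: "\<lbrakk>1 \<le> a; a \<le> b; b \<le> 3\<rbrakk> \<Longrightarrow> Q l (a, b) = (if a = l \<and> b = l then \<one>\<^bsub>M l l\<^esub> else \<zero>\<^bsub>M a b\<^esub>)"
  by (simp add: tri_Q_unit tri_unit_entry)

text \<open>Matrix products are often computed by a single summand; this covers products with the diagonal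
  idempotents and with matrix units.\<close>

lemma mu_eq_tri_mult:
  assumes "1 \<le> i" "i \<le> j" "j \<le> k" "k \<le> 3" and x: "x \<in> carrier T" and y: "y \<in> carrier T"
    and xr: "\<And>l. \<lbrakk>i \<le> l; l \<le> k; l \<noteq> j\<rbrakk> \<Longrightarrow> x (i, l) = \<zero>\<^bsub>M i l\<^esub> \<or> y (l, k) = \<zero>\<^bsub>M l k\<^esub>"
  shows "(x \<otimes>\<^bsub>T\<^esub> y) (i, k) = \<mu> i j k (x (i, j)) (y (j, k))"
proof -
  interpret G: abelian_group "M i k" by (rule M_group) (use assms in auto)
  have "(x \<otimes>\<^bsub>T\<^esub> y) (i, k) = finsum (M i k) (\<lambda>l. \<mu> i l k (x (i, l)) (y (l, k))) {i..k}"
    using assms by (simp add: tri_ring_def)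
  also have "\<dots> = finsum (M i k) (\<lambda>l. if j = l then \<mu> i l k (x (i, l)) (y (l, k)) else \<zero>\<^bsub>M i k\<^esub>) {i..k}"
  proof (rule G.finsum_cong')
    fix l assume l: "l \<in> {i..k}"
    show "\<mu> i l k (x (i, l)) (y (l, k)) = (if j = l then \<mu> i l k (x (i, l)) (y (l, k)) else \<zero>\<^bsub>M i k\<^esub>)"
      using xr[of l] l assms(1-4) tri_ring_entry[OF x, of i l] tri_ring_entry[OF y, of l k]
      by (auto simp: mu_zero_left mu_zero_right)
  qed (use assms in \<open>auto simp: mu_closed tri_ring_entry\<close>)
  also have "\<dots> = \<mu> i j k (x (i, j)) (y (j, k))"
    using assms by (intro G.finsum_singleton) (auto simp: mu_closed tri_ring_entry)
  finally show ?thesis .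
qed

lemma Q_mult_left:
  assumes x: "x \<in> carrier T" and l: "1 \<le> l" "l \<le> 3" and ab: "1 \<le> a" "a \<le> b" "b \<le> 3"
  shows "(Q l \<otimes>\<^bsub>T\<^esub> x) (a, b) = (if a = l then x (a, b) else \<zero>\<^bsub>M a b\<^esub>)"
proof -
  have "(Q l \<otimes>\<^bsub>T\<^esub> x) (a, b) = \<mu> a a b (Q l (a, a)) (x (a, b))"
    using assms by (intro mu_eq_tri_mult) (auto simp: Q_closed Q_entry)
  then show ?thesis
    using ab tri_ring_entry[OF x ab] by (auto simp: Q_entry mu_one_left mu_zero_left)
qed

lemma Q_mult_right:
  assumes x: "x \<in> carrier T" and l: "1 \<le> l" "l \<le> 3" and ab: "1 \<le> a" "a \<le> b" "b \<le> 3"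
  shows "(x \<otimes>\<^bsub>T\<^esub> Q l) (a, b) = (if b = l then x (a, b) else \<zero>\<^bsub>M a b\<^esub>)"
proof -
  have "(x \<otimes>\<^bsub>T\<^esub> Q l) (a, b) = \<mu> a b b (x (a, b)) (Q l (b, b))"
    using assms by (intro mu_eq_tri_mult) (auto simp: Q_closed Q_entry)
  then show ?thesis
    using ab tri_ring_entry[OF x ab] by (auto simp: Q_entry mu_one_right mu_zero_right)
qed

lemma Q_sandwich_entry:
  assumes x: "x \<in> carrier T" and "1 \<le> k" "k \<le> 3" "1 \<le> l" "l \<le> 3" and ab: "1 \<le> a" "a \<le> b" "b \<le> 3"
  shows "(Q k \<otimes>\<^bsub>T\<^esub> x \<otimes>\<^bsub>T\<^esub> Q l) (a, b) = (if a = k \<and> b = l then x (a, b) else \<zero>\<^bsub>M a b\<^esub>)"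
  using assms by (simp add: Q_mult_right Q_mult_left tri_closed Q_closed)

lemma Q_lower_zero:
  assumes x: "x \<in> carrier T" and kl: "1 \<le> l" "l < k" "k \<le> 3"
  shows "Q k \<otimes>\<^bsub>T\<^esub> x \<otimes>\<^bsub>T\<^esub> Q l = \<zero>\<^bsub>T\<^esub>"
  by (rule tri_ring_eqI[where M = M and \<mu> = \<mu>])
    (use x kl in \<open>auto simp: Q_sandwich_entry tri_ring_simps tri_closed Q_closed simp del: One_nat_def\<close>)

lemma Q_orthogonal:
  assumes "1 \<le> k" "k \<le> 3" "1 \<le> l" "l \<le> 3"
  shows "Q k \<otimes>\<^bsub>T\<^esub> Q l = (if k = l then Q l else \<zero>\<^bsub>T\<^esub>)"
  by (rule tri_ring_eqI[where M = M and \<mu> = \<mu>])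
    (use assms in \<open>auto simp: Q_mult_left Q_entry tri_ring_simps tri_closed Q_closed simp del: One_nat_def\<close>)

lemma Q_sum: "Q 1 \<oplus>\<^bsub>T\<^esub> (Q 2 \<oplus>\<^bsub>T\<^esub> Q 3) = \<one>\<^bsub>T\<^esub>"
  by (rule tri_ring_eqI[where M = M and \<mu> = \<mu>])
    (simp_all add: Q_entry tri_ring_simps tri_closed Q_closed M_zero M_one_closed del: One_nat_def)

text \<open>Multiplying a matrix concentrated in position \<open>(i, i)\<close> by the matrix units in position \<open>(i, j)\<close>
  recovers the left action of \<open>R i\<close> on \<open>M i j\<close>.\<close>

lemma faithful_row:
  assumes ij: "1 \<le> i" "i < j" "j \<le> 3" and a: "a \<in> carrier T" "Q i \<otimes>\<^bsub>T\<^esub> a \<otimes>\<^bsub>T\<^esub> Q i = a"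
    and 0: "\<forall>x \<in> carrier T. a \<otimes>\<^bsub>T\<^esub> x \<otimes>\<^bsub>T\<^esub> Q j = \<zero>\<^bsub>T\<^esub>"
  shows "a = \<zero>\<^bsub>T\<^esub>"
proof -
  have off: "a (k, l) = \<zero>\<^bsub>M k l\<^esub>" if "1 \<le> k" "k \<le> l" "l \<le> 3" "k \<noteq> i \<or> l \<noteq> i" for k l
    using Q_sandwich_entry[OF a(1), of i i k l] ij that by (auto simp: a(2))
  have "a (i, i) = \<zero>\<^bsub>R i\<^esub>"
  proof (rule faithful_left[of i j])
    show "a (i, i) \<in> carrier (R i)" using tri_ring_entry[OF a(1), of i i] ij diag[of i] by simp
    show "\<forall>m \<in> carrier (M i j). \<mu> i i j (a (i, i)) m = \<zero>\<^bsub>M i j\<^esub>"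
    proof
      fix m assume m: "m \<in> carrier (M i j)"
      define x where "x = tri_unit M i j m"
      have x: "x \<in> carrier T" "x (i, j) = m" using ij m by (auto simp: x_def tri_unit_closed tri_unit_entry)
      have "\<mu> i i j (a (i, i)) m = (a \<otimes>\<^bsub>T\<^esub> x) (i, j)"
        using ij x a(1) off[of i] by (subst mu_eq_tri_mult[of i i j]) auto
      also have "\<dots> = (a \<otimes>\<^bsub>T\<^esub> x \<otimes>\<^bsub>T\<^esub> Q j) (i, j)"
        using ij x a(1) by (simp add: Q_mult_right tri_closed)
      also have "\<dots> = \<zero>\<^bsub>M i j\<^esub>" using ij x 0 by (simp add: tri_ring_simps)
      finally show "\<mu> i i j (a (i, i)) m = \<zero>\<^bsub>M i j\<^esub>" .
    qed
  qed (use ij in auto)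
  then have "a (k, l) = \<zero>\<^bsub>M k l\<^esub>" if "1 \<le> k" "k \<le> l" "l \<le> 3" for k l
    using off[of k l] that diag[of i] ij by fastforce
  then show ?thesis
    using a(1) by (intro tri_ring_eqI[where M = M and \<mu> = \<mu>]) (simp_all add: tri_closed tri_ring_simps)
qed

lemma faithful_column:
  assumes ij: "1 \<le> i" "i < j" "j \<le> 3" and a: "a \<in> carrier T" "Q j \<otimes>\<^bsub>T\<^esub> a \<otimes>\<^bsub>T\<^esub> Q j = a"
    and 0: "\<forall>x \<in> carrier T. Q i \<otimes>\<^bsub>T\<^esub> (x \<otimes>\<^bsub>T\<^esub> a) = \<zero>\<^bsub>T\<^esub>"
  shows "a = \<zero>\<^bsub>T\<^esub>"
proof -
  have off: "a (k, l) = \<zero>\<^bsub>M k l\<^esub>" if "1 \<le> k" "k \<le> l" "l \<le> 3" "k \<noteq> j \<or> l \<noteq> j" for k l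
    using Q_sandwich_entry[OF a(1), of j j k l] ij that by (auto simp: a(2))
  have "a (j, j) = \<zero>\<^bsub>R j\<^esub>"
  proof (rule faithful_right[of i j])
    show "a (j, j) \<in> carrier (R j)" using tri_ring_entry[OF a(1), of j j] ij diag[of j] by simp
    show "\<forall>m \<in> carrier (M i j). \<mu> i j j m (a (j, j)) = \<zero>\<^bsub>M i j\<^esub>"
    proof
      fix m assume m: "m \<in> carrier (M i j)"
      define x where "x = tri_unit M i j m"
      have x: "x \<in> carrier T" "x (i, j) = m" using ij m by (auto simp: x_def tri_unit_closed tri_unit_entry)
      have "\<mu> i j j m (a (j, j)) = (x \<otimes>\<^bsub>T\<^esub> a) (i, j)"
        using ij x a(1) off[of _ j] by (subst mu_eq_tri_mult[of i j j]) auto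
      also have "\<dots> = (Q i \<otimes>\<^bsub>T\<^esub> (x \<otimes>\<^bsub>T\<^esub> a)) (i, j)"
        using ij x a(1) by (simp add: Q_mult_left tri_closed)
      also have "\<dots> = \<zero>\<^bsub>M i j\<^esub>" using ij x 0 by (simp add: tri_ring_simps)
      finally show "\<mu> i j j m (a (j, j)) = \<zero>\<^bsub>M i j\<^esub>" .
    qed
  qed (use ij in auto)
  then have "a (k, l) = \<zero>\<^bsub>M k l\<^esub>" if "1 \<le> k" "k \<le> l" "l \<le> 3" for k l
    using off[of k l] that diag[of j] ij by fastforce
  then show ?thesis
    using a(1) by (intro tri_ring_eqI[where M = M and \<mu> = \<mu>]) (simp_all add: tri_closed tri_ring_simps)
qed

text \<open>An element of the lower corner that annihilates \<open>M\<^sub>1\<^sub>2\<close> and \<open>M\<^sub>1\<^sub>3\<close> has zero diagonal, by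
  faithfulness of the right actions on these modules. Only the \<open>(2, 3)\<close> entry survives, and it
  annihilates \<open>M\<^sub>1\<^sub>2\<close>.\<close>

lemma annihilator_first_row:
  assumes s: "s \<in> carrier T"
    and row: "Q 1 \<otimes>\<^bsub>T\<^esub> s = \<zero>\<^bsub>T\<^esub>"
    and ann: "\<And>j m. \<lbrakk>j \<in> {2, 3}; m \<in> carrier (M 1 j)\<rbrakk> \<Longrightarrow> tri_unit M 1 j m \<otimes>\<^bsub>T\<^esub> s = \<zero>\<^bsub>T\<^esub>"
  shows "s \<in> tri_S1 M \<mu>"
proof -
  have row1: "s (1, j) = \<zero>\<^bsub>M 1 j\<^esub>" if "1 \<le> j" "j \<le> 3" for j
    using Q_mult_left[OF s, of 1 1 j] that by (simp add: row tri_ring_simps del: One_nat_def)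
  have entry: "\<mu> 1 j k m (s (j, k)) = \<zero>\<^bsub>M 1 k\<^esub>" if j: "j \<in> {2, 3}" and k: "j \<le> k" "k \<le> 3" and m: "m \<in> carrier (M 1 j)" for j k m
  proof -
    have "tri_unit M 1 j m \<in> carrier T" using j m by (intro tri_unit_closed) auto
    then have "(tri_unit M 1 j m \<otimes>\<^bsub>T\<^esub> s) (1, k) = \<mu> 1 j k (tri_unit M 1 j m (1, j)) (s (j, k))"
      using j k s by (intro mu_eq_tri_mult) (auto simp: tri_unit_entry)
    then show ?thesis using j k ann[OF j m] by (auto simp: tri_unit_entry tri_ring_simps)
  qed
  have d: "s (j, j) = \<zero>\<^bsub>M j j\<^esub>" if j: "j \<in> {2, 3}" for j
  proof -
    have "s (j, j) = \<zero>\<^bsub>R j\<^esub>"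
      using j entry[OF j, of j] tri_ring_entry[OF s, of j j] diag[of j] by (intro faithful_right[of 1 j]) auto
    then show ?thesis using j diag[of j] by auto
  qed
  have "s (2, 3) \<in> tri_V23 M \<mu>"
    using entry[of 2 3] tri_ring_entry[OF s, of 2 3] by (simp add: tri_V23_def)
  then show ?thesis
    using s row1 d by (auto simp: tri_S1_def upper3_eq)
qed

text \<open>The mirror image for the corner of \<open>Q\<^sub>1 + Q\<^sub>2\<close>.\<close>

lemma annihilator_last_column:
  assumes s: "s \<in> carrier T"
    and col: "s \<otimes>\<^bsub>T\<^esub> Q 3 = \<zero>\<^bsub>T\<^esub>"
    and ann: "\<And>i m. \<lbrakk>i \<in> {1, 2}; m \<in> carrier (M i 3)\<rbrakk> \<Longrightarrow> s \<otimes>\<^bsub>T\<^esub> tri_unit M i 3 m = \<zero>\<^bsub>T\<^esub>"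
  shows "s \<in> tri_S3 M \<mu>"
proof -
  have col3: "s (i, 3) = \<zero>\<^bsub>M i 3\<^esub>" if "1 \<le> i" "i \<le> 3" for i
    using Q_mult_right[OF s, of 3 i 3] that by (simp add: col tri_ring_simps)
  have entry: "\<mu> h i 3 (s (h, i)) m = \<zero>\<^bsub>M h 3\<^esub>" if i: "i \<in> {1, 2}" and h: "1 \<le> h" "h \<le> i" and m: "m \<in> carrier (M i 3)" for h i m
  proof -
    have "tri_unit M i 3 m \<in> carrier T" using i m by (intro tri_unit_closed) auto
    then have "(s \<otimes>\<^bsub>T\<^esub> tri_unit M i 3 m) (h, 3) = \<mu> h i 3 (s (h, i)) (tri_unit M i 3 m (i, 3))"
      using i h s by (intro mu_eq_tri_mult) (auto simp: tri_unit_entry)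
    then show ?thesis using i h ann[OF i m] by (auto simp: tri_unit_entry tri_ring_simps)
  qed
  have d: "s (i, i) = \<zero>\<^bsub>M i i\<^esub>" if i: "i \<in> {1, 2}" for i
  proof -
    have "s (i, i) = \<zero>\<^bsub>R i\<^esub>"
      using i entry[OF i, of i] tri_ring_entry[OF s, of i i] diag[of i] by (intro faithful_left[of i 3]) auto
    then show ?thesis using i diag[of i] by auto
  qed
  have "s (1, 2) \<in> tri_V12 M \<mu>"
    using entry[of 2 1] tri_ring_entry[OF s, of 1 2] by (simp add: tri_V12_def)
  then show ?thesis
    using s col3 d by (auto simp: tri_S3_def upper3_eq)
qed

lemma Q_tri_unit:
  assumes "1 \<le> i" "i \<le> j" "j \<le> 3" "m \<in> carrier (M i j)" "1 \<le> l" "l \<le> 3"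
  shows "Q l \<otimes>\<^bsub>T\<^esub> tri_unit M i j m = (if l = i then tri_unit M i j m else \<zero>\<^bsub>T\<^esub>)"
    "tri_unit M i j m \<otimes>\<^bsub>T\<^esub> Q l = (if l = j then tri_unit M i j m else \<zero>\<^bsub>T\<^esub>)"
proof -
  note u = tri_unit_closed[OF assms(1-4)]
  show "Q l \<otimes>\<^bsub>T\<^esub> tri_unit M i j m = (if l = i then tri_unit M i j m else \<zero>\<^bsub>T\<^esub>)"
    by (rule tri_ring_eqI[where M = M and \<mu> = \<mu>])
      (use u assms(5,6) in \<open>auto simp: tri_closed Q_closed Q_mult_left tri_unit_entry tri_ring_simps simp del: One_nat_def\<close>)
  show "tri_unit M i j m \<otimes>\<^bsub>T\<^esub> Q l = (if l = j then tri_unit M i j m else \<zero>\<^bsub>T\<^esub>)"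
    by (rule tri_ring_eqI[where M = M and \<mu> = \<mu>])
      (use u assms(5,6) in \<open>auto simp: tri_closed Q_closed Q_mult_right tri_unit_entry tri_ring_simps simp del: One_nat_def\<close>)
qed

end

section \<open>Decomposition over the triangular 3-matrix ring\<close>

context triangular3
begin

lemma Q'_first: "tri_Q' M \<mu> 1 = Q 2 \<oplus>\<^bsub>T\<^esub> Q 3"
proof -
  interpret ring T by (rule ring_tri_ring)
  have c: "Q 1 \<in> carrier T" "Q 2 \<in> carrier T" "Q 3 \<in> carrier T" by (auto intro: Q_closed)
  show ?thesis
    unfolding tri_Q'_def Q_sum[symmetric] a_comm[OF c(1) a_closed[OF c(2,3)]]
    using c by (intro minus_cancel_right) auto
qed

lemma Q'_last: "tri_Q' M \<mu> 3 = Q 1 \<oplus>\<^bsub>T\<^esub> Q 2"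
proof -
  interpret ring T by (rule ring_tri_ring)
  have c: "Q 1 \<in> carrier T" "Q 2 \<in> carrier T" "Q 3 \<in> carrier T" by (auto intro: Q_closed)
  show ?thesis unfolding tri_Q'_def Q_sum[symmetric] using c by algebra
qed

lemma split_first:
  assumes "corner T (Q 1) (ring_center T) = ring_center (corner_ring T (Q 1))"
    and "corner T (tri_Q' M \<mu> 1) (ring_center T) = ring_center (corner_ring T (tri_Q' M \<mu> 1))"
  shows "split_triangular_peirce T (Q 1) (tri_Q' M \<mu> 1) (Q 2) (Q 3)"
proof -
  interpret ring T by (rule ring_tri_ring)
  have c: "Q 1 \<in> carrier T" "Q 2 \<in> carrier T" "Q 3 \<in> carrier T" by (auto intro: Q_closed)
  show ?thesis
  proof unfold_locales
    fix x assume x: "x \<in> carrier T"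
    have "Q 2 \<otimes>\<^bsub>T\<^esub> x \<otimes>\<^bsub>T\<^esub> Q 1 = \<zero>\<^bsub>T\<^esub>" "Q 3 \<otimes>\<^bsub>T\<^esub> x \<otimes>\<^bsub>T\<^esub> Q 1 = \<zero>\<^bsub>T\<^esub>"
      using x by (auto intro!: Q_lower_zero)
    then show "tri_Q' M \<mu> 1 \<otimes>\<^bsub>T\<^esub> x \<otimes>\<^bsub>T\<^esub> Q 1 = \<zero>\<^bsub>T\<^esub>"
      unfolding Q'_first using c x by (simp add: l_distr)
  next
    fix a assume "a \<in> carrier T" "Q 1 \<otimes>\<^bsub>T\<^esub> a \<otimes>\<^bsub>T\<^esub> Q 1 = a" "\<forall>x\<in>carrier T. a \<otimes>\<^bsub>T\<^esub> x \<otimes>\<^bsub>T\<^esub> Q 2 = \<zero>\<^bsub>T\<^esub>"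
    then show "a = \<zero>\<^bsub>T\<^esub>" by (intro faithful_row[of 1 2 a]) auto
  next
    fix a assume "a \<in> carrier T" "Q 1 \<otimes>\<^bsub>T\<^esub> a \<otimes>\<^bsub>T\<^esub> Q 1 = a" "\<forall>x\<in>carrier T. a \<otimes>\<^bsub>T\<^esub> x \<otimes>\<^bsub>T\<^esub> Q 3 = \<zero>\<^bsub>T\<^esub>"
    then show "a = \<zero>\<^bsub>T\<^esub>" by (intro faithful_row[of 1 3 a]) auto
  qed (use c assms in \<open>simp_all add: Q'_first Q_sum Q_orthogonal del: One_nat_def\<close>)
qed

text \<open>Reversing the multiplication turns \<open>Q\<^sub>3\<close> into the upper idempotent, since
  \<open>Q\<^sub>3 T (Q\<^sub>1 + Q\<^sub>2) = 0\<close>.\<close>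

lemma split_last:
  assumes "corner T (Q 3) (ring_center T) = ring_center (corner_ring T (Q 3))"
    and "corner T (tri_Q' M \<mu> 3) (ring_center T) = ring_center (corner_ring T (tri_Q' M \<mu> 3))"
  shows "split_triangular_peirce (opposite_ring T) (Q 3) (tri_Q' M \<mu> 3) (Q 1) (Q 2)"
proof -
  interpret ring T by (rule ring_tri_ring)
  interpret op: ring "opposite_ring T" by (rule ring_opposite_ring)
  have c: "Q 1 \<in> carrier T" "Q 2 \<in> carrier T" "Q 3 \<in> carrier T" by (auto intro: Q_closed)
  have f: "tri_Q' M \<mu> 3 \<in> carrier T" unfolding Q'_last using c by simp
  have ff: "tri_Q' M \<mu> 3 \<otimes>\<^bsub>T\<^esub> tri_Q' M \<mu> 3 = tri_Q' M \<mu> 3"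
    unfolding Q'_last using c by (simp add: l_distr r_distr Q_orthogonal del: One_nat_def)
  have center: "corner (opposite_ring T) p (ring_center (opposite_ring T)) = ring_center (corner_ring (opposite_ring T) p)"
    if p: "p \<in> carrier T" "p \<otimes>\<^bsub>T\<^esub> p = p"
      and eq: "corner T p (ring_center T) = ring_center (corner_ring T p)" for p
  proof -
    have "corner (opposite_ring T) p (ring_center (opposite_ring T)) = corner T p (ring_center T)"
      unfolding ring_center_opposite_ring using p(1) by (rule corner_opposite_ring) (auto simp: ring_center_def)
    also note eq
    also have "ring_center (corner_ring T p) = ring_center (corner_ring (opposite_ring T) p)"
      unfolding corner_ring_opposite_ring[OF p(1)]
      by (rule ring.ring_center_opposite_ring[OF ring_corner_ring[OF p], symmetric])
    finally show ?thesis .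
  qed
  show ?thesis
  proof unfold_locales
    show "Q 3 \<oplus>\<^bsub>opposite_ring T\<^esub> tri_Q' M \<mu> 3 = \<one>\<^bsub>opposite_ring T\<^esub>"
      unfolding Q'_last using c Q_sum by (simp add: a_ac del: One_nat_def)
    fix x assume x: "x \<in> carrier (opposite_ring T)"
    then have "Q 3 \<otimes>\<^bsub>T\<^esub> x \<otimes>\<^bsub>T\<^esub> Q 1 = \<zero>\<^bsub>T\<^esub>" "Q 3 \<otimes>\<^bsub>T\<^esub> x \<otimes>\<^bsub>T\<^esub> Q 2 = \<zero>\<^bsub>T\<^esub>"
      by (auto intro!: Q_lower_zero)
    then show "tri_Q' M \<mu> 3 \<otimes>\<^bsub>opposite_ring T\<^esub> x \<otimes>\<^bsub>opposite_ring T\<^esub> Q 3 = \<zero>\<^bsub>opposite_ring T\<^esub>"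
      unfolding Q'_last using c x by (simp add: r_distr m_assoc)
  next
    fix a assume "a \<in> carrier (opposite_ring T)" "Q 3 \<otimes>\<^bsub>opposite_ring T\<^esub> a \<otimes>\<^bsub>opposite_ring T\<^esub> Q 3 = a"
      "\<forall>x\<in>carrier (opposite_ring T). a \<otimes>\<^bsub>opposite_ring T\<^esub> x \<otimes>\<^bsub>opposite_ring T\<^esub> Q 1 = \<zero>\<^bsub>opposite_ring T\<^esub>"
    then show "a = \<zero>\<^bsub>opposite_ring T\<^esub>" using c by (auto intro!: faithful_column[of 1 3 a] simp: m_assoc simp del: One_nat_def)
  next
    fix a assume "a \<in> carrier (opposite_ring T)" "Q 3 \<otimes>\<^bsub>opposite_ring T\<^esub> a \<otimes>\<^bsub>opposite_ring T\<^esub> Q 3 = a"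
      "\<forall>x\<in>carrier (opposite_ring T). a \<otimes>\<^bsub>opposite_ring T\<^esub> x \<otimes>\<^bsub>opposite_ring T\<^esub> Q 2 = \<zero>\<^bsub>opposite_ring T\<^esub>"
    then show "a = \<zero>\<^bsub>opposite_ring T\<^esub>" using c by (auto intro!: faithful_column[of 2 3 a] simp: m_assoc)
  next
    show "corner (opposite_ring T) (Q 3) (ring_center (opposite_ring T)) = ring_center (corner_ring (opposite_ring T) (Q 3))"
      by (rule center[OF c(3) _ assms(1)]) (simp add: Q_orthogonal)
    show "corner (opposite_ring T) (tri_Q' M \<mu> 3) (ring_center (opposite_ring T)) =
        ring_center (corner_ring (opposite_ring T) (tri_Q' M \<mu> 3))"
      by (rule center[OF f ff assms(2)])
  qed (use c f assms in \<open>simp_all add: Q'_last Q_orthogonal del: One_nat_def\<close>)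
qed

lemma decomposition_first:
  assumes "corner T (Q 1) (ring_center T) = ring_center (corner_ring T (Q 1))"
    and "corner T (tri_Q' M \<mu> 1) (ring_center T) = ring_center (corner_ring T (tri_Q' M \<mu> 1))"
    and "\<forall>\<psi>. mult_lie_derivation (corner_ring T (tri_Q' M \<mu> 1)) \<psi> \<longrightarrow>
      has_standard_form (corner_ring T (tri_Q' M \<mu> 1)) \<psi>"
    and "mult_lie_derivation T \<phi>"
  shows "\<exists>\<delta> \<gamma> \<xi>. ring_derivation T \<delta> \<and> central_vanishing_on_brackets T \<gamma> \<and>
    mult_lie_derivation T \<xi> \<and> \<xi> \<in> carrier T \<rightarrow> tri_S1 M \<mu> \<and>
    (\<forall>x \<in> carrier T. \<phi> x = \<delta> x \<oplus>\<^bsub>T\<^esub> \<gamma> x \<oplus>\<^bsub>T\<^esub> \<xi> x)"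
proof -
  interpret split_triangular_peirce T "Q 1" "tri_Q' M \<mu> 1" "Q 2" "Q 3"
    using assms(1,2) by (rule split_first)
  have c: "Q 1 \<in> carrier T" "Q 2 \<in> carrier T" "Q 3 \<in> carrier T" by (auto intro: Q_closed)
  have "off_annihilator \<subseteq> tri_S1 M \<mu>"
  proof
    fix s assume "s \<in> off_annihilator"
    then have s: "s \<in> BB" and ann: "\<And>n. n \<in> NN \<Longrightarrow> n \<otimes>\<^bsub>T\<^esub> s = \<zero>\<^bsub>T\<^esub>" by (auto simp: off_annihilator_def simp del: One_nat_def)
    have sc: "s \<in> carrier T" using s by (rule in_carrier)
    show "s \<in> tri_S1 M \<mu>"
    proof (rule annihilator_first_row[OF sc])
      have "Q 1 \<otimes>\<^bsub>T\<^esub> pf s = \<zero>\<^bsub>T\<^esub>"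
        using sc by (simp add: pf_def m_assoc idem_absorb del: One_nat_def)
      then show "Q 1 \<otimes>\<^bsub>T\<^esub> s = \<zero>\<^bsub>T\<^esub>" by (simp add: proj_BB[OF s] del: One_nat_def)
    next
      fix j m assume j: "j \<in> {2, 3::nat}" and m: "m \<in> carrier (M 1 j)"
      have u: "tri_unit M 1 j m \<in> carrier T" using j m by (intro tri_unit_closed) auto
      have "tri_unit M 1 j m \<in> NN"
        unfolding NN_def pn_def unfolding Q'_first using u j m c
        by (auto simp: r_distr Q_tri_unit simp del: One_nat_def)
      then show "tri_unit M 1 j m \<otimes>\<^bsub>T\<^esub> s = \<zero>\<^bsub>T\<^esub>" by (rule ann)
    qed
  qed
  with lie_derivation_decomposition[OF assms(3,4)] show ?thesis by blast
qed

lemma decomposition_last: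
  assumes "corner T (Q 3) (ring_center T) = ring_center (corner_ring T (Q 3))"
    and "corner T (tri_Q' M \<mu> 3) (ring_center T) = ring_center (corner_ring T (tri_Q' M \<mu> 3))"
    and std: "\<forall>\<psi>. mult_lie_derivation (corner_ring T (tri_Q' M \<mu> 3)) \<psi> \<longrightarrow>
      has_standard_form (corner_ring T (tri_Q' M \<mu> 3)) \<psi>"
    and lie: "mult_lie_derivation T \<phi>"
  shows "\<exists>\<delta> \<gamma> \<xi>. ring_derivation T \<delta> \<and> central_vanishing_on_brackets T \<gamma> \<and>
    mult_lie_derivation T \<xi> \<and> \<xi> \<in> carrier T \<rightarrow> tri_S3 M \<mu> \<and>
    (\<forall>x \<in> carrier T. \<phi> x = \<delta> x \<oplus>\<^bsub>T\<^esub> \<gamma> x \<oplus>\<^bsub>T\<^esub> \<xi> x)"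
proof -
  interpret T: ring T by (rule ring_tri_ring)
  interpret op: split_triangular_peirce "opposite_ring T" "Q 3" "tri_Q' M \<mu> 3" "Q 1" "Q 2"
    using assms(1,2) by (rule split_last)
  have c: "Q 1 \<in> carrier T" "Q 2 \<in> carrier T" "Q 3 \<in> carrier T" by (auto intro: Q_closed)
  have f: "tri_Q' M \<mu> 3 \<in> carrier T" using op.f_closed by simp
  interpret corner: ring "corner_ring T (tri_Q' M \<mu> 3)"
    using f op.f_idem by (intro T.ring_corner_ring) simp_all
  have "op.off_annihilator \<subseteq> tri_S3 M \<mu>"
  proof
    fix s assume "s \<in> op.off_annihilator"
    then have s: "s \<in> op.BB" and ann: "\<And>n. n \<in> op.NN \<Longrightarrow> s \<otimes>\<^bsub>T\<^esub> n = \<zero>\<^bsub>T\<^esub>" by (auto simp: op.off_annihilator_def)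
    have sc: "s \<in> carrier T" using op.in_carrier(3)[OF s] by simp
    show "s \<in> tri_S3 M \<mu>"
    proof (rule annihilator_last_column[OF sc])
      have "tri_Q' M \<mu> 3 \<otimes>\<^bsub>T\<^esub> Q 3 = \<zero>\<^bsub>T\<^esub>" using op.e_f by simp
      then have "op.pf s \<otimes>\<^bsub>T\<^esub> Q 3 = \<zero>\<^bsub>T\<^esub>"
        using sc f c by (simp add: op.pf_def T.m_assoc)
      then show "s \<otimes>\<^bsub>T\<^esub> Q 3 = \<zero>\<^bsub>T\<^esub>" by (simp add: op.proj_BB[OF s])
    next
      fix i m assume i: "i \<in> {1, 2::nat}" and m: "m \<in> carrier (M i 3)"
      have u: "tri_unit M i 3 m \<in> carrier T" using i m by (intro tri_unit_closed) auto
      have "tri_unit M i 3 m \<in> op.NN"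
        unfolding op.NN_def op.pn_def unfolding Q'_last using u i m c
        by (auto simp: T.l_distr T.r_distr Q_tri_unit simp del: One_nat_def)
      then show "s \<otimes>\<^bsub>T\<^esub> tri_unit M i 3 m = \<zero>\<^bsub>T\<^esub>" by (rule ann)
    qed
  qed
  moreover have "\<forall>\<psi>. mult_lie_derivation (corner_ring (opposite_ring T) (tri_Q' M \<mu> 3)) \<psi> \<longrightarrow>
      has_standard_form (corner_ring (opposite_ring T) (tri_Q' M \<mu> 3)) \<psi>"
    using std by (simp add: T.corner_ring_opposite_ring[OF f]
        corner.mult_lie_derivation_opposite_ring corner.has_standard_form_opposite_ring)
  moreover have "mult_lie_derivation (opposite_ring T) \<phi>"
    using lie by (simp add: T.mult_lie_derivation_opposite_ring)
  ultimately show ?thesis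
    using op.lie_derivation_decomposition[of \<phi>]
    by (simp add: T.ring_derivation_opposite_ring T.mult_lie_derivation_opposite_ring
        T.central_vanishing_on_brackets_opposite_ring) blast
qed

end

theorem theorem3p1:
  fixes R :: "nat \<Rightarrow> 'a ring"
    and M :: "nat \<Rightarrow> nat \<Rightarrow> 'a ring"
    and \<mu> :: "nat \<Rightarrow> nat \<Rightarrow> nat \<Rightarrow> 'a \<Rightarrow> 'a \<Rightarrow> 'a"
    and T :: "(nat \<times> nat \<Rightarrow> 'a) ring"
    and k :: nat
    and \<phi> :: "(nat \<times> nat \<Rightarrow> 'a) \<Rightarrow> (nat \<times> nat \<Rightarrow> 'a)"
  assumes "triangular3 R M \<mu>"
    and "T = tri_ring M \<mu>"
    and "k \<in> {1, 3}"
    and "corner T (tri_Q M k) (ring_center T) = ring_center (corner_ring T (tri_Q M k))"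
    and "corner T (tri_Q' M \<mu> k) (ring_center T) = ring_center (corner_ring T (tri_Q' M \<mu> k))"
    and "\<forall>f. mult_lie_derivation (corner_ring T (tri_Q' M \<mu> k)) f \<longrightarrow>
              has_standard_form (corner_ring T (tri_Q' M \<mu> k)) f"
    and "mult_lie_derivation T \<phi>"
  shows "\<exists>\<delta> \<gamma> \<xi>.
      ring_derivation T \<delta> \<and>
      central_vanishing_on_brackets T \<gamma> \<and>
      mult_lie_derivation T \<xi> \<and>
      \<xi> \<in> carrier T \<rightarrow> (if k = 1 then tri_S1 M \<mu> else tri_S3 M \<mu>) \<and>
      (\<forall>x \<in> carrier T. \<phi> x = \<delta> x \<oplus>\<^bsub>T\<^esub> \<gamma> x \<oplus>\<^bsub>T\<^esub> \<xi> x)"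
proof -
  note hyps = assms(4-7)[unfolded assms(2)]
  consider "k = 1" | "k = 3" using assms(3) by auto
  then show ?thesis
  proof cases
    case 1
    show ?thesis
      using triangular3.decomposition_first[OF assms(1) hyps[unfolded 1]] unfolding 1 assms(2) by simp
  next
    case 2
    show ?thesis
      using triangular3.decomposition_last[OF assms(1) hyps[unfolded 2]] unfolding 2 assms(2) by simp
  qed
qed

end
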